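(* Let $\lambda\in(0,\infty)$ and let $(n_j)_{j\ge1}$, $(d_j)_{j\ge 1}$ be sequences of positive integers with $n_j\to\infty$ and $n_j2^{-d_j}\to\lambda$ as $j\to\infty$. Let $f_{n_j,d_j}$ be uniformly chosen from $\mathrm{Hom}(P_{n_j,d_j},0)$. If all $n_j$ are even, then $$|\mathrm{Rng}(f_{n_j,d_j})|\xrightarrow[j\to\infty]{(d)}|\mathrm{Rng}(S_{N^+(\lambda)})|+2,$$ and if all $n_j$ are odd, then $$|\mathrm{Rng}(f_{n_j,d_j})|\xrightarrow[j\to\infty]{(d)}|\mathrm{Rng}(S_{N^-(\lambda)})|+2,$$ where $\xrightarrow{(d)}$ denotes convergence in distribution.
   Context: For $n,d\ge 1$, $P_{n,d}$ is the graph with vertex set $\{0,1,\dots,n\}$ in which $i,j$ are adjacent iff $|i-j|\in\{1,3,\dots,2d+1\}$. $\mathrm{Hom}(P_{n,d},0)$ is the finite set of functions $f\colon\{0,\dots,n\}\to\mathbb{Z}$ with $f(0)=0$ and $|f(i)-f(j)|=1$ whenever $i,j$ are adjacent in $P_{n,d}$. $\mathrm{Rng}(f)$ denotes the set of values taken by $f$. For $\kappa,\alpha>0$, the parity-biased Poisson distribution $\mu(\kappa,\alpha)$ is the distribution on $\{0,1,2,\dots\}$ given by $$\mu(\kappa,\alpha)=\frac{\alpha}{\alpha+\tanh(\kappa)}\,\mu^{\mathrm{even}}(\kappa)+\frac{\tanh(\kappa)}{\alpha+\tanh(\kappa)}\,\mu^{\mathrm{odd}}(\kappa),$$ where $\mu^{\mathrm{even}}(\kappa)$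 (resp. $\mu^{\mathrm{odd}}(\kappa)$) is the law of a Poisson($\kappa$) variable conditioned to be even (resp. odd). Equivalently, $\mu(\kappa,\alpha)(r)$ is proportional to $\alpha(r)\kappa^r/r!$, $r\ge0$, where $\alpha(r)=\alpha$ for even $r$ and $\alpha(r)=1$ for odd $r$. $(S_i)_{i\ge0}$ is a simple random walk on $\mathbb{Z}$ (with $S_0=0$), and for an integer $k\ge0$, $\mathrm{Rng}(S_k):=\{S_i : 0\le i\le k\}$. $N^{+}(\lambda)\sim\mu\big(\lambda/(2\sqrt2),\,3/(2\sqrt2)\big)$ and $N^{-}(\lambda)\sim\mu\big(\lambda/(2\sqrt2),\,2\sqrt2/3\big)$ are each independent of $(S_i)_{i\ge0}$. *)

theory Defs
  imports "HOL-Probability.Probability"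
begin

definition P_adj :: "nat \<Rightarrow> nat \<Rightarrow> nat \<Rightarrow> nat \<Rightarrow> bool" where
  "P_adj n d i j \<longleftrightarrow>
     i \<in> {0..n} \<and> j \<in> {0..n} \<and> \<bar>int i - int j\<bar> \<in> {2 * int k + 1 | k. k \<in> {0..d}}"

text \<open>
  Functions on \<open>{0..n}\<close> are represented as extensional functions (equal to \<open>undefined\<close>
  outside \<open>{0..n}\<close>), so that the set is finite and counts every homomorphism once.
\<close>

definition Hom0 :: "nat \<Rightarrow> nat \<Rightarrow> (nat \<Rightarrow> int) set" where
  "Hom0 n d =
     {f \<in> {0..n} \<rightarrow>\<^sub>E UNIV. f 0 = 0 \<and> (\<forall>i j. P_adj n d i j \<longrightarrow> \<bar>f i - f j\<bar> = 1)}"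

text \<open>
  \<^const>\<open>pmf_of_set\<close> is only specified on finite nonempty sets; the next two lemmas show
  that \<^term>\<open>pmf_of_set (Hom0 n d)\<close> is the uniform distribution.
\<close>

lemma Hom0_nonempty: "Hom0 n d \<noteq> {}"
proof -
  define f :: "nat \<Rightarrow> int" where "f = restrict (\<lambda>i. int i mod 2) {0..n}"
  have "\<bar>f i - f j\<bar> = 1" if "P_adj n d i j" for i j
  proof -
    from that obtain k where k: "\<bar>int i - int j\<bar> = 2 * int k + 1" and ij: "i \<le> n" "j \<le> n"
      by (auto simp: P_adj_def)
    from k have "\<bar>int i mod 2 - int j mod 2\<bar> = 1" by presburger
    with ij show ?thesis by (simp add: f_def)
  qed
  then have "f \<in> Hom0 n d"
    by (auto simp: Hom0_def f_def)
  then show ?thesis by blast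
qed

lemma Hom0_finite: "finite (Hom0 n d)"
proof (rule finite_subset)
  show "Hom0 n d \<subseteq> {0..n} \<rightarrow>\<^sub>E {- int n..int n}"
  proof
    fix f assume f: "f \<in> Hom0 n d"
    have bound: "\<bar>f i\<bar> \<le> int i" if "i \<le> n" for i
      using that
    proof (induction i)
      case 0
      then show ?case using f by (simp add: Hom0_def)
    next
      case (Suc i)
      have "P_adj n d (Suc i) i"
        using Suc.prems by (auto simp: P_adj_def intro!: exI[of _ 0])
      then have "\<bar>f (Suc i) - f i\<bar> = 1" using f by (simp add: Hom0_def)
      then show ?case using Suc by linarith
    qed
    have "f i \<in> {- int n..int n}" if "i \<in> {0..n}" for i
      using bound[of i] that by (simp add: abs_le_iff)
    then show "f \<in> {0..n} \<rightarrow>\<^sub>E {- int n..int n}"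
      using f by (auto simp: Hom0_def PiE_def)
  qed
qed (intro finite_PiE; simp)

definition poisson_even_pmf :: "real \<Rightarrow> nat pmf" where
  "poisson_even_pmf \<kappa> = cond_pmf (poisson_pmf \<kappa>) {r. even r}"

definition poisson_odd_pmf :: "real \<Rightarrow> nat pmf" where
  "poisson_odd_pmf \<kappa> = cond_pmf (poisson_pmf \<kappa>) {r. odd r}"

text \<open>
  The mixture of the two conditioned laws is realised by first tossing a coin that selects the
  even law with probability \<open>\<alpha> / (\<alpha> + tanh \<kappa>)\<close>.  Meaningful for \<open>\<kappa>, \<alpha> > 0\<close>.
\<close>

definition parity_biased_poisson :: "real \<Rightarrow> real \<Rightarrow> nat pmf" where
  "parity_biased_poisson \<kappa> \<alpha> =
     bernoulli_pmf (\<alpha> / (\<alpha> + tanh \<kappa>)) \<bind>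
       (\<lambda>b. if b then poisson_even_pmf \<kappa> else poisson_odd_pmf \<kappa>)"

definition simple_random_walk :: "'a measure \<Rightarrow> (nat \<Rightarrow> 'a \<Rightarrow> int) \<Rightarrow> bool" where
  "simple_random_walk M S \<longleftrightarrow>
     prob_space M \<and>
     (\<forall>\<omega>\<in>space M. S 0 \<omega> = 0) \<and>
     prob_space.indep_vars M (\<lambda>_. count_space UNIV) (\<lambda>i \<omega>. S (Suc i) \<omega> - S i \<omega>) UNIV \<and>
     (\<forall>i. distr M (count_space UNIV) (\<lambda>\<omega>. S (Suc i) \<omega> - S i \<omega>) =
          measure_pmf (pmf_of_set {-1, 1}))"

text \<open>
  \<^const>\<open>prob_space.indep_var\<close> requires both random variables to have the same type, so
  independence of \<open>N\<close> from the whole process \<open>(S\<^sub>i)\<close> is stated, in the same way as the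
  library does, by independence of the \<open>\<sigma>\<close>-algebras they generate.
\<close>

definition independent_time ::
    "'a measure \<Rightarrow> (nat \<Rightarrow> 'a \<Rightarrow> int) \<Rightarrow> ('a \<Rightarrow> nat) \<Rightarrow> nat pmf \<Rightarrow> bool" where
  "independent_time M S N p \<longleftrightarrow>
     N \<in> measurable M (count_space UNIV) \<and>
     distr M (count_space UNIV) N = measure_pmf p \<and>
     (\<lambda>\<omega> i. S i \<omega>) \<in> measurable M (\<Pi>\<^sub>M i\<in>UNIV. count_space UNIV) \<and>
     prob_space.indep_set M
       {N -` A \<inter> space M | A. A \<in> sets (count_space UNIV)}
       {(\<lambda>\<omega> i. S i \<omega>) -` B \<inter> space M | B. B \<in> sets (\<Pi>\<^sub>M i\<in>UNIV. count_space UNIV)}"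

definition hom_range_size_distr :: "nat \<Rightarrow> nat \<Rightarrow> real measure" where
  "hom_range_size_distr n d =
     distr (measure_pmf (pmf_of_set (Hom0 n d))) borel (\<lambda>f. real (card (f ` {0..n})))"

definition walk_range :: "(nat \<Rightarrow> 'a \<Rightarrow> int) \<Rightarrow> nat \<Rightarrow> 'a \<Rightarrow> int set" where
  "walk_range S k \<omega> = {S i \<omega> | i. i \<le> k}"

end

theory Submission
  imports Defs
begin

text \<open>
  Say that \<open>f\<close> jumps at \<open>i\<close> if \<open>f i \<noteq> f (i - 2)\<close>. A vertex may jump only if none of the \<open>d\<close> preceding
  vertices of the other parity class did, so one parity class stays constant, equal to a centre,
  while the other one oscillates freely around it by \<open>\<plusminus>1\<close>; the two classes exchange their roles
  only after a jump-free stretch of about \<open>2 d\<close> vertices, and then the centre moves by \<open>\<plusminus>1\<close>. The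
  range of \<open>f\<close> is exactly the set of visited centres and their neighbours, which explains the
  additional \<open>2\<close>.

  Counting continuations after a jump by the number of remaining vertices gives
  \<open>u (m + 2) = 2 u m + u (m + 1 - 2 d)\<close> in total. This bounds the size of \<^term>\<open>Hom0 n d\<close> from above by
  a combination of \<open>cosh\<close> and \<open>sinh\<close>. With a prescribed list of \<open>r\<close> centre steps, the same recursion
  bounds the number of functions from below by a binomial coefficient, which is asymptotically
  \<open>2\<^sup>-\<^sup>r\<close> times the weight of \<open>r\<close> under the parity-biased Poisson law. As these lower bounds already
  sum up to a probability distribution, no matching upper bound for single patterns is needed.
\<close>

section \<open>Words and centre steps\<close>

text \<open>
  A state consists of the centre \<open>c\<close>, the current value \<open>y = c \<plusminus> 1\<close> of the oscillating class, and the
  number \<open>k\<close> of further repetitions of \<open>y\<close> needed before the two classes may exchange their roles.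
  In \<open>accA\<close> the next vertex belongs to the class frozen at \<open>c\<close>, in \<open>accB\<close> to the oscillating one.
\<close>

fun accA :: "nat \<Rightarrow> nat \<Rightarrow> int \<Rightarrow> int \<Rightarrow> int list \<Rightarrow> bool"
  and accB :: "nat \<Rightarrow> nat \<Rightarrow> int \<Rightarrow> int \<Rightarrow> int list \<Rightarrow> bool" where
  "accA d k c y [] \<longleftrightarrow> True"
| "accA d k c y (v # vs) \<longleftrightarrow>
     v = c \<and> accB d k c y vs \<or> k = 0 \<and> v = 2 * y - c \<and> accA d d y v vs"
| "accB d k c y [] \<longleftrightarrow> True"
| "accB d k c y (v # vs) \<longleftrightarrow>
     v = y \<and> accA d (k - 1) c y vs \<or> v = 2 * c - y \<and> accA d d c v vs"

text \<open>On accepted words a value other than \<open>c\<close> at a frozen position can only be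
  an exchange of the classes, so the moves of the centre are read off without the counter. Jumps of
  the oscillating class leave the centre where it is.\<close>

fun stepsA :: "int \<Rightarrow> int \<Rightarrow> int list \<Rightarrow> int list"
  and stepsB :: "int \<Rightarrow> int \<Rightarrow> int list \<Rightarrow> int list" where
  "stepsA c y [] = []"
| "stepsA c y (v # vs) = (if v = c then stepsB c y vs else (y - c) # stepsA y v vs)"
| "stepsB c y [] = []"
| "stepsB c y (v # vs) = stepsA c v vs"

text \<open>Before the first jump the centre is not yet determined: \<open>x\<close> and \<open>y\<close> are the last two values.\<close>

fun acc0 :: "nat \<Rightarrow> int \<Rightarrow> int \<Rightarrow> int list \<Rightarrow> bool" where
  "acc0 d x y [] \<longleftrightarrow> True"
| "acc0 d x y (v # vs) \<longleftrightarrow> v = x \<and> acc0 d y x vs \<or> v = 2 * y - x \<and> accA d d y v vs"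

text \<open>\<open>None\<close> marks the words without any jump, for which no centre is determined.
  Otherwise the list starts at the centre \<open>y\<close> fixed by the first jump.\<close>

fun steps0 :: "int \<Rightarrow> int \<Rightarrow> int list \<Rightarrow> int list option" where
  "steps0 x y [] = None"
| "steps0 x y (v # vs) = (if v = x then steps0 y x vs else Some (stepsA y v vs))"

text \<open>With counter 0 either class may jump next, so the centre is as undetermined as before
  the first jump. Facts on \<open>accA\<close> with counter 0 thus carry over to
  \<open>acc0\<close>.\<close>

lemma acc_zero_eq_acc0:
  "accA d 0 c y vs \<longleftrightarrow> acc0 d c y vs"
  "accB d 0 c y vs \<longleftrightarrow> acc0 d y c vs"
  by (induction vs arbitrary: c y) auto

section \<open>Counting accepted words by length and list of centre steps\<close>

definition cntA :: "nat \<Rightarrow> nat \<Rightarrow> int \<Rightarrow> int \<Rightarrow> (int list \<Rightarrow> bool) \<Rightarrow> nat \<Rightarrow> nat" where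
  "cntA d k c y P m = card {vs. length vs = m \<and> accA d k c y vs \<and> P (stepsA c y vs)}"

definition cntB :: "nat \<Rightarrow> nat \<Rightarrow> int \<Rightarrow> int \<Rightarrow> (int list \<Rightarrow> bool) \<Rightarrow> nat \<Rightarrow> nat" where
  "cntB d k c y P m = card {vs. length vs = m \<and> accB d k c y vs \<and> P (stepsB c y vs)}"

definition cnt0 :: "nat \<Rightarrow> int \<Rightarrow> int \<Rightarrow> (int list option \<Rightarrow> bool) \<Rightarrow> nat \<Rightarrow> nat" where
  "cnt0 d x y P m = card {vs. length vs = m \<and> acc0 d x y vs \<and> P (steps0 x y vs)}"

lemma finite_acc:
  "finite {vs. length vs = m \<and> accA d k c y vs}"
  "finite {vs. length vs = m \<and> accB d k c y vs}"
proof (induction m arbitrary: k c y)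
  case (Suc m)
  { case 1
    have "{vs. length vs = Suc m \<and> accA d k c y vs} \<subseteq>
        (#) c ` {vs. length vs = m \<and> accB d k c y vs} \<union>
        (#) (2 * y - c) ` {vs. length vs = m \<and> accA d d y (2 * y - c) vs}"
      by (auto simp: length_Suc_conv)
    then show ?case using Suc by (meson finite_UnI finite_imageI finite_subset)
  next
    case 2
    have "{vs. length vs = Suc m \<and> accB d k c y vs} \<subseteq>
        (#) y ` {vs. length vs = m \<and> accA d (k - 1) c y vs} \<union>
        (#) (2 * c - y) ` {vs. length vs = m \<and> accA d d c (2 * c - y) vs}"
      by (auto simp: length_Suc_conv)
    then show ?case using Suc by (meson finite_UnI finite_imageI finite_subset) }
qed auto

lemma finite_acc0: "finite {vs. length vs = m \<and> acc0 d x y vs}"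
  using finite_acc(1)[of m d 0 x y] by (simp add: acc_zero_eq_acc0)

lemma card_Cons_image: "card ((#) v ` X) = card X"
  by (simp add: card_image)

lemma cntA_0 [simp]: "cntA d k c y P 0 = (if P [] then 1 else 0)"
proof -
  have "{vs. length vs = 0 \<and> accA d k c y vs \<and> P (stepsA c y vs)} = (if P [] then {[]} else {})"
    by auto
  then show ?thesis by (simp add: cntA_def)
qed

lemma cntB_0 [simp]: "cntB d k c y P 0 = (if P [] then 1 else 0)"
proof -
  have "{vs. length vs = 0 \<and> accB d k c y vs \<and> P (stepsB c y vs)} = (if P [] then {[]} else {})"
    by auto
  then show ?thesis by (simp add: cntB_def)
qed

lemma cnt0_0 [simp]: "cnt0 d x y P 0 = (if P None then 1 else 0)"
proof -
  have "{vs. length vs = 0 \<and> acc0 d x y vs \<and> P (steps0 x y vs)} = (if P None then {[]} else {})"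
    by auto
  then show ?thesis by (simp add: cnt0_def)
qed

lemma cntA_Suc:
  assumes "c \<noteq> y"
  shows "cntA d k c y P (Suc m) = cntB d k c y P m +
    (if k = 0 then cntA d d y (2 * y - c) (\<lambda>es. P ((y - c) # es)) m else 0)"
proof -
  let ?B = "{vs. length vs = m \<and> accB d k c y vs \<and> P (stepsB c y vs)}"
  let ?A = "{vs. length vs = m \<and> accA d d y (2 * y - c) vs \<and> P ((y - c) # stepsA y (2 * y - c) vs)}"
  have "{vs. length vs = Suc m \<and> accA d k c y vs \<and> P (stepsA c y vs)} =
      (#) c ` ?B \<union> (if k = 0 then (#) (2 * y - c) ` ?A else {})"
    using assms by (auto simp: length_Suc_conv)
  moreover have "finite ?A" "finite ?B"
    by (auto intro: finite_subset[OF _ finite_acc(1)[of m]] finite_subset[OF _ finite_acc(2)[of m]])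
  moreover have "(#) c ` ?B \<inter> (#) (2 * y - c) ` ?A = {}" using assms by auto
  ultimately show ?thesis
    by (cases "k = 0") (simp_all add: cntA_def cntB_def card_Un_disjoint card_Cons_image)
qed

lemma cntB_Suc:
  assumes "c \<noteq> y"
  shows "cntB d k c y P (Suc m) = cntA d (k - 1) c y P m + cntA d d c (2 * c - y) P m"
proof -
  let ?A = "{vs. length vs = m \<and> accA d (k - 1) c y vs \<and> P (stepsA c y vs)}"
  let ?B = "{vs. length vs = m \<and> accA d d c (2 * c - y) vs \<and> P (stepsA c (2 * c - y) vs)}"
  have "{vs. length vs = Suc m \<and> accB d k c y vs \<and> P (stepsB c y vs)} =
      (#) y ` ?A \<union> (#) (2 * c - y) ` ?B"
    using assms by (auto simp: length_Suc_conv)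
  moreover have "finite ?A" "finite ?B"
    by (auto intro: finite_subset[OF _ finite_acc(1)[of m]])
  moreover have "(#) y ` ?A \<inter> (#) (2 * c - y) ` ?B = {}" using assms by auto
  ultimately show ?thesis
    by (simp add: cntA_def cntB_def card_Un_disjoint card_Cons_image)
qed

lemma cnt0_Suc:
  assumes "x \<noteq> y"
  shows "cnt0 d x y P (Suc m) =
    cnt0 d y x P m + cntA d d y (2 * y - x) (\<lambda>es. P (Some es)) m"
proof -
  let ?A = "{vs. length vs = m \<and> acc0 d y x vs \<and> P (steps0 y x vs)}"
  let ?B = "{vs. length vs = m \<and> accA d d y (2 * y - x) vs \<and> P (Some (stepsA y (2 * y - x) vs))}"
  have "{vs. length vs = Suc m \<and> acc0 d x y vs \<and> P (steps0 x y vs)} =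
      (#) x ` ?A \<union> (#) (2 * y - x) ` ?B"
    using assms by (auto simp: length_Suc_conv)
  moreover have "finite ?A" "finite ?B"
    by (auto intro: finite_subset[OF _ finite_acc(1)[of m]] finite_subset[OF _ finite_acc0[of m]])
  moreover have "(#) x ` ?A \<inter> (#) (2 * y - x) ` ?B = {}" using assms by auto
  ultimately show ?thesis
    by (simp add: cntA_def cnt0_def card_Un_disjoint card_Cons_image)
qed

text \<open>
  Lowering the counter by one only adds the words whose first switch comes as early as the
  lower counter permits.
\<close>

lemma cntA_counter:
  assumes "c \<noteq> y"
  shows "cntA d k c y P m = cntA d (Suc k) c y P m +
    (if m < Suc (2 * k) then 0
     else cntA d d y (2 * y - c) (\<lambda>es. P ((y - c) # es)) (m - Suc (2 * k)))"
  using assms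
proof (induction m arbitrary: k rule: less_induct)
  case (less m)
  consider "m = 0" | "m = 1" | l where "m = Suc (Suc l)"
    by (metis One_nat_def not0_implies_Suc)
  then show ?case
  proof cases
    case 3
    show ?thesis
    proof (cases k)
      case 0
      then show ?thesis using less.prems 3 by (simp add: cntA_Suc cntB_Suc)
    next
      case (Suc k')
      then show ?thesis using less.prems 3 less.IH[of l k'] by (simp add: cntA_Suc cntB_Suc)
    qed
  qed (use less.prems in \<open>auto simp: cntA_Suc\<close>)
qed

abbreviation cnt :: "nat \<Rightarrow> int \<Rightarrow> int \<Rightarrow> (int list \<Rightarrow> bool) \<Rightarrow> nat \<Rightarrow> nat" where
  "cnt d \<equiv> cntA d d"

lemma cnt_1: "c \<noteq> y \<Longrightarrow> 0 < d \<Longrightarrow> cnt d c y P (Suc 0) = (if P [] then 1 else 0)"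
  by (simp add: cntA_Suc)

text \<open>As \<open>d\<close> is positive, the first letter must be \<open>c\<close>. The second
  is \<open>y\<close>, leaving counter \<open>d - 1\<close>, or the jump to
  \<open>2 * c - y\<close>, which resets the counter. \<open>cntA_counter\<close> lifts
  \<open>d - 1\<close> back to \<open>d\<close> at the price of the switch term with its delay
  \<open>2 * d - 1\<close>.\<close>

lemma cnt_rec:
  assumes "c \<noteq> y" "0 < d"
  shows "cnt d c y P (Suc (Suc m)) = cnt d c y P m + cnt d c (2 * c - y) P m +
    (if m < 2 * d - 1 then 0
     else cnt d y (2 * y - c) (\<lambda>es. P ((y - c) # es)) (m - (2 * d - 1)))"
proof -
  obtain k where k: "d = Suc k" using assms(2) by (cases d) auto
  have "cnt d c y P (Suc (Suc m)) = cntA d k c y P m + cnt d c (2 * c - y) P m"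
    using assms(1) k by (simp add: cntA_Suc cntB_Suc)
  then show ?thesis
    using cntA_counter[OF assms(1), of d k P m] k by simp
qed

section \<open>Values of a word and visited centres\<close>

fun centres :: "int \<Rightarrow> int list \<Rightarrow> int set" where
  "centres c [] = {c}"
| "centres c (e # es) = insert c (centres (c + e) es)"

definition tube :: "int set \<Rightarrow> int set" where
  "tube X = (\<Union>x\<in>X. {x - 1, x, x + 1})"

lemma tube_simps [simp]: "tube {} = {}" "tube (insert x X) = {x - 1, x, x + 1} \<union> tube X"
  by (auto simp: tube_def)

lemma nbr_set: "\<bar>y - c\<bar> = 1 \<Longrightarrow> {c, y, 2 * c - y} = {c - 1, c, c + (1::int)}"
  by auto

text \<open>Adding both neighbours of the centre to the values makes the claim inductive: a jump
  only swaps \<open>y\<close> and \<open>2 * c - y\<close>, and after an exchange the new centre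
  \<open>y\<close> has the neighbours \<open>c\<close> and \<open>v = 2 * y - c\<close>.\<close>

lemma steps_range:
  assumes "\<bar>y - c\<bar> = 1"
  shows "accA d k c y vs \<Longrightarrow> {c, y, 2 * c - y} \<union> set vs = tube (centres c (stepsA c y vs))"
    and "accB d k c y vs \<Longrightarrow> {c, y, 2 * c - y} \<union> set vs = tube (centres c (stepsB c y vs))"
  using assms
proof (induction vs arbitrary: k c y)
  case Nil
  { case 1 then show ?case using nbr_set[of y c] by simp
  next
    case 2 then show ?case using nbr_set[of y c] by simp }
next
  case (Cons v vs)
  { case 1
    show ?case
    proof (cases "v = c")
      case True
      with 1 have "accB d k c y vs" by auto
      from Cons(2)[OF this 1(2)] show ?thesis using True by (simp add: insert_commute) blast
    next
      case False
      with 1 have v: "v = 2 * y - c" and acc: "accA d d y v vs" by auto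
      have "{y, v, 2 * y - v} \<union> set vs = tube (centres y (stepsA y v vs))"
        by (rule Cons(1)[OF acc]) (use v 1(2) in \<open>simp add: abs_minus_commute\<close>)
      then have "tube (centres c (stepsA c y (v # vs))) =
          {c - 1, c, c + 1} \<union> ({y, v, 2 * y - v} \<union> set vs)"
        using False by simp
      also have "{c - 1, c, c + 1} = {c, y, 2 * c - y}"
        using nbr_set[of y c] 1(2) by simp
      also have "{c, y, 2 * c - y} \<union> ({y, v, 2 * y - v} \<union> set vs) = {c, y, 2 * c - y} \<union> set (v # vs)"
        using v by auto
      finally show ?thesis by simp
    qed
  next
    case 2
    consider "v = y" "accA d (k - 1) c y vs" | "v = 2 * c - y" "accA d d c v vs"
      using 2(1) by auto
    then show ?case
    proof cases
      case A: 1
      from Cons(1)[OF A(2) 2(2)] A(1) show ?thesis by (simp add: insert_commute) blast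
    next
      case B: 2
      have "{c, v, 2 * c - v} \<union> set vs = tube (centres c (stepsA c v vs))"
        by (rule Cons(1)[OF B(2)]) (use B(1) 2(2) in \<open>simp add: abs_minus_commute\<close>)
      then show ?thesis using B(1) by (simp add: insert_commute) blast
    qed }
qed

lemma steps_unit:
  "accA d k c y vs \<Longrightarrow> \<bar>y - c\<bar> = 1 \<Longrightarrow> set (stepsA c y vs) \<subseteq> {-1, 1}"
  "accB d k c y vs \<Longrightarrow> \<bar>y - c\<bar> = 1 \<Longrightarrow> set (stepsB c y vs) \<subseteq> {-1, 1}"
proof (induction d k c y vs and d k c y vs rule: accA_accB.induct)
  case (2 d k c y v vs)
  show ?case
  proof (cases "v = c")
    case False
    then have "set (stepsA y v vs) \<subseteq> {-1, 1}" using 2 by auto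
    moreover have "y - c \<in> {-1, 1}" using 2 by auto
    ultimately show ?thesis using False by simp
  qed (use 2 in auto)
next
  case (4 d k c y v vs)
  then show ?case by (auto simp: abs_minus_commute)
qed auto

lemma centres_shift: "centres c es = (+) c ` centres 0 es"
proof (induction es arbitrary: c)
  case (Cons e es)
  show ?case
    using Cons[of "c + e"] Cons[of e] by (simp add: image_image add.assoc)
qed auto

lemma card_centres: "card (centres c es) = card (centres 0 es)"
  by (subst centres_shift) (simp add: card_image)

lemma centres_interval:
  assumes "set es \<subseteq> {-1, 1}"
  shows "\<exists>a b. a \<le> c \<and> c \<le> b \<and> centres c es = {a..b}"
  using assms
proof (induction es arbitrary: c)
  case Nil
  show ?case by (intro exI[of _ c]) auto
next
  case (Cons e es)
  then obtain a b where ab: "a \<le> c + e" "c + e \<le> b" "centres (c + e) es = {a..b}" by force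
  have "e = 1 \<or> e = -1" using Cons by auto
  then have "x \<in> insert c {a..b} \<longleftrightarrow> x \<in> {min a c..max b c}" for x
    using ab(1,2) unfolding insert_iff atLeastAtMost_iff min_def max_def by presburger
  then have "insert c {a..b} = {min a c..max b c}" by blast
  then have "centres c (e # es) = {min a c..max b c}" using ab by simp
  then show ?case by (meson max.cobounded2 min.cobounded2)
qed

text \<open>Unit steps visit an interval, and passing to neighbours lengthens it by one point at
  each end.\<close>

lemma card_tube_centres:
  assumes "set es \<subseteq> {-1, 1}"
  shows "card (tube (centres c es)) = card (centres 0 es) + 2"
proof -
  obtain a b where ab: "a \<le> c" "c \<le> b" "centres c es = {a..b}"
    using centres_interval[OF assms] by blast
  have "tube {a..b} = {a - 1..b + 1}"
  proof
    show "{a - 1..b + 1} \<subseteq> tube {a..b}"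
    proof
      fix x assume x: "x \<in> {a - 1..b + 1}"
      \<comment> \<open>The point of \<open>{a..b}\<close> nearest to \<open>x\<close>.\<close>
      define z where "z = min b (max a x)"
      have "z \<in> {a..b}" "x \<in> {z - 1, z, z + 1}" using x ab by (auto simp: z_def)
      then show "x \<in> tube {a..b}" unfolding tube_def by blast
    qed
  qed (auto simp: tube_def)
  then have "card (tube (centres c es)) = nat (b - a + 3)" using ab by simp
  moreover have "card (centres c es) = nat (b - a + 1)" using ab by simp
  ultimately show ?thesis using ab card_centres[of c es] by linarith
qed

text \<open>At the first jump the centre is \<open>y\<close>, and its neighbours \<open>x\<close>
  and \<open>v = 2 * y - x\<close> have both been seen, so the values added in
  \<open>steps_range\<close> are genuine ones.\<close>

lemma steps0_range:
  assumes "acc0 d x y vs" "\<bar>y - x\<bar> = 1" "steps0 x y vs = Some es"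
  shows "card ({x, y} \<union> set vs) = card (centres 0 es) + 2"
proof -
  have "\<exists>c. {x, y} \<union> set vs = tube (centres c es) \<and> set es \<subseteq> {-1, 1}"
    using assms
  proof (induction vs arbitrary: x y)
    case (Cons v vs)
    show ?case
    proof (cases "v = x")
      case True
      with Cons.prems have "acc0 d y x vs" "\<bar>x - y\<bar> = 1" "steps0 y x vs = Some es"
        by auto
      from Cons.IH[OF this] show ?thesis using True by (simp add: insert_commute)
    next
      case False
      then have v: "v = 2 * y - x" "accA d d y v vs" "es = stepsA y v vs"
        using Cons.prems by auto
      have 1: "\<bar>v - y\<bar> = 1" using v(1) Cons.prems(2) by simp
      have "{y, v, 2 * y - v} \<union> set vs = tube (centres y es)"
        using steps_range(1)[OF 1 v(2)] v(3) by simp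
      moreover have "2 * y - v = x" using v(1) by simp
      ultimately have "{x, y} \<union> set (v # vs) = tube (centres y es)"
        by (simp add: insert_commute)
      then show ?thesis
        using steps_unit(1)[OF v(2) 1] v(3) by blast
    qed
  qed simp
  then show ?thesis using card_tube_centres by force
qed

section \<open>Homomorphisms as accepted words\<close>

text \<open>Vertex \<open>Suc i\<close> is tested against its earlier neighbours only, so that a
  homomorphism can be read from left to right.\<close>

definition step :: "(nat \<Rightarrow> int) \<Rightarrow> nat \<Rightarrow> nat \<Rightarrow> bool" where
  "step f d i \<longleftrightarrow> (\<forall>p\<le>i. even (i + p) \<and> i \<le> p + 2 * d \<longrightarrow> \<bar>f (Suc i) - f p\<bar> = 1)"

text \<open>Invariants satisfied at vertex \<open>i\<close> by a function whose history leads to the respective state.\<close>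

definition stateA :: "(nat \<Rightarrow> int) \<Rightarrow> nat \<Rightarrow> nat \<Rightarrow> int \<Rightarrow> int \<Rightarrow> nat \<Rightarrow> bool" where
  "stateA f d k c y i \<longleftrightarrow> \<bar>y - c\<bar> = 1 \<and> k \<le> d \<and> 1 \<le> i \<and> f i = y \<and>
     (\<forall>p\<le>i. odd (i + p) \<and> i \<le> p + 2 * d + 1 \<longrightarrow> f p = c) \<and>
     (\<forall>p\<le>i. even (i + p) \<and> i + 2 * k \<le> p + 2 * d \<longrightarrow> f p = y) \<and>
     (\<forall>p\<le>i. even (i + p) \<and> i \<le> p + 2 * d \<longrightarrow> \<bar>f p - c\<bar> = 1) \<and>
     (0 < k \<longrightarrow> (\<exists>p\<le>i. even (i + p) \<and> i + 2 * k = p + 2 * d + 2 \<and> f p = 2 * c - y))"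

definition stateB :: "(nat \<Rightarrow> int) \<Rightarrow> nat \<Rightarrow> nat \<Rightarrow> int \<Rightarrow> int \<Rightarrow> nat \<Rightarrow> bool" where
  "stateB f d k c y i \<longleftrightarrow> \<bar>y - c\<bar> = 1 \<and> k \<le> d \<and> 1 \<le> i \<and> f i = c \<and>
     (\<forall>p\<le>i. even (i + p) \<and> i \<le> p + 2 * d + 2 \<longrightarrow> f p = c) \<and>
     (\<forall>p\<le>i. odd (i + p) \<and> i + 2 * k \<le> p + 2 * d + 1 \<longrightarrow> f p = y) \<and>
     (\<forall>p\<le>i. odd (i + p) \<and> i \<le> p + 2 * d + 1 \<longrightarrow> \<bar>f p - c\<bar> = 1) \<and>
     (0 < k \<longrightarrow> (\<exists>p\<le>i. odd (i + p) \<and> i + 2 * k = p + 2 * d + 3 \<and> f p = 2 * c - y))"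

lemma unit_dist_iff: "\<bar>y - c\<bar> = 1 \<Longrightarrow> \<bar>v - c\<bar> = 1 \<longleftrightarrow> v = y \<or> v = 2 * c - (y::int)"
  by arith

lemma stateA_to_B:
  assumes "stateA f d k c y i" "f (Suc i) = c"
  shows "stateB f d k c y (Suc i)"
proof -
  have 1: "\<bar>y - c\<bar> = 1" "1 \<le> i" "f i = y" "k \<le> d"
    and 2: "\<And>p. p \<le> i \<Longrightarrow> odd (i + p) \<Longrightarrow> i \<le> p + 2 * d + 1 \<Longrightarrow> f p = c"
    and 3: "\<And>p. p \<le> i \<Longrightarrow> even (i + p) \<Longrightarrow> i + 2 * k \<le> p + 2 * d \<Longrightarrow> f p = y"
    and 4: "\<And>p. p \<le> i \<Longrightarrow> even (i + p) \<Longrightarrow> i \<le> p + 2 * d \<Longrightarrow> \<bar>f p - c\<bar> = 1"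
    and 5: "0 < k \<longrightarrow> (\<exists>p\<le>i. even (i + p) \<and> i + 2 * k = p + 2 * d + 2 \<and> f p = 2 * c - y)"
    using assms unfolding stateA_def by auto
  show ?thesis
    unfolding stateB_def
  proof (intro conjI allI impI)
    fix p assume p: "p \<le> Suc i" "even (Suc i + p) \<and> Suc i \<le> p + 2 * d + 2"
    show "f p = c"
    proof (cases "p = Suc i")
      case False
      then show ?thesis using p by (intro 2) auto
    qed (use assms(2) in simp)
  next
    fix p assume p: "p \<le> Suc i" "odd (Suc i + p) \<and> Suc i + 2 * k \<le> p + 2 * d + 1"
    then show "f p = y" by (cases "p = Suc i") (auto intro: 3)
  next
    fix p assume p: "p \<le> Suc i" "odd (Suc i + p) \<and> Suc i \<le> p + 2 * d + 1"
    then show "\<bar>f p - c\<bar> = 1" by (cases "p = Suc i") (auto intro: 4)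
  next
    assume "0 < k"
    then obtain p where "p \<le> i" "even (i + p)" "i + 2 * k = p + 2 * d + 2" "f p = 2 * c - y"
      using 5 by auto
    then show "\<exists>p\<le>Suc i. odd (Suc i + p) \<and> Suc i + 2 * k = p + 2 * d + 3 \<and> f p = 2 * c - y"
      by (intro exI[of _ p]) auto
  qed (use 1 assms(2) in simp_all)
qed

lemma stateA_switch:
  assumes "stateA f d 0 c y i" "f (Suc i) = 2 * y - c" "1 \<le> d"
  shows "stateA f d d y (2 * y - c) (Suc i)"
proof -
  have 1: "\<bar>y - c\<bar> = 1" "1 \<le> i" "f i = y"
    and 2: "\<And>p. p \<le> i \<Longrightarrow> odd (i + p) \<Longrightarrow> i \<le> p + 2 * d + 1 \<Longrightarrow> f p = c"
    and 3: "\<And>p. p \<le> i \<Longrightarrow> even (i + p) \<Longrightarrow> i \<le> p + 2 * d \<Longrightarrow> f p = y"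
    using assms unfolding stateA_def by auto
  \<comment> \<open>Two vertices before \<open>Suc i\<close> stands \<open>c\<close>, the other
    neighbour of the new centre \<open>y\<close>. It is the witness for the full counter
    \<open>d\<close>.\<close>
  have 4: "f (i - 1) = c" using 1(2) by (intro 2) auto
  show ?thesis
    unfolding stateA_def
  proof (intro conjI allI impI)
    fix p assume p: "p \<le> Suc i" "odd (Suc i + p) \<and> Suc i \<le> p + 2 * d + 1"
    then show "f p = y" by (cases "p = Suc i") (auto intro: 3)
  next
    fix p assume p: "p \<le> Suc i" "even (Suc i + p) \<and> Suc i + 2 * d \<le> p + 2 * d"
    then have "p = Suc i" by simp
    then show "f p = 2 * y - c" using assms by simp
  next
    fix p assume p: "p \<le> Suc i" "even (Suc i + p) \<and> Suc i \<le> p + 2 * d"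
    show "\<bar>f p - y\<bar> = 1"
    proof (cases "p = Suc i")
      case False
      then have "f p = c" using p by (intro 2) auto
      then show ?thesis using 1 by (simp add: abs_minus_commute)
    qed (use 1 assms in \<open>simp add: abs_minus_commute\<close>)
  next
    show "\<exists>p\<le>Suc i. even (Suc i + p) \<and> Suc i + 2 * d = p + 2 * d + 2 \<and> f p = 2 * y - (2 * y - c)"
      using 1(2) 4 by (intro exI[of _ "i - 1"]) auto
  qed (use 1 assms(2) in \<open>simp_all add: abs_minus_commute\<close>)
qed

lemma stateB_to_A:
  assumes "stateB f d k c y i" "f (Suc i) = y" "1 \<le> d"
  shows "stateA f d (k - 1) c y (Suc i)"
proof -
  have 1: "\<bar>y - c\<bar> = 1" "1 \<le> i" "f i = c" "k \<le> d"
    and 2: "\<And>p. p \<le> i \<Longrightarrow> even (i + p) \<Longrightarrow> i \<le> p + 2 * d + 2 \<Longrightarrow> f p = c"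
    and 3: "\<And>p. p \<le> i \<Longrightarrow> odd (i + p) \<Longrightarrow> i + 2 * k \<le> p + 2 * d + 1 \<Longrightarrow> f p = y"
    and 4: "\<And>p. p \<le> i \<Longrightarrow> odd (i + p) \<Longrightarrow> i \<le> p + 2 * d + 1 \<Longrightarrow> \<bar>f p - c\<bar> = 1"
    and 5: "0 < k \<longrightarrow> (\<exists>p\<le>i. odd (i + p) \<and> i + 2 * k = p + 2 * d + 3 \<and> f p = 2 * c - y)"
    using assms unfolding stateB_def by auto
  show ?thesis
    unfolding stateA_def
  proof (intro conjI allI impI)
    fix p assume p: "p \<le> Suc i" "odd (Suc i + p) \<and> Suc i \<le> p + 2 * d + 1"
    then show "f p = c" by (cases "p = Suc i") (auto intro: 2)
  next
    fix p assume p: "p \<le> Suc i" "even (Suc i + p) \<and> Suc i + 2 * (k - 1) \<le> p + 2 * d"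
    show "f p = y"
    proof (cases "p = Suc i")
      case False
      then show ?thesis using p by (intro 3) auto
    qed (use assms(2) in simp)
  next
    fix p assume p: "p \<le> Suc i" "even (Suc i + p) \<and> Suc i \<le> p + 2 * d"
    show "\<bar>f p - c\<bar> = 1"
    proof (cases "p = Suc i")
      case False
      then show ?thesis using p by (intro 4) auto
    qed (use assms(2) 1(1) in simp)
  next
    assume k: "0 < k - 1"
    then obtain p where "p\<le>i" "odd (i + p)" "i + 2 * k = p + 2 * d + 3" "f p = 2 * c - y"
      using 5 by auto
    then show "\<exists>p\<le>Suc i. even (Suc i + p) \<and> Suc i + 2 * (k - 1) = p + 2 * d + 2 \<and> f p = 2 * c - y"
      using k by (intro exI[of _ p]) auto
  qed (use 1 assms(2) in simp_all)
qed

lemma stateB_jump: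
  assumes "stateB f d k c y i" "f (Suc i) = 2 * c - y" "1 \<le> d"
  shows "stateA f d d c (2 * c - y) (Suc i)"
proof -
  have 1: "\<bar>y - c\<bar> = 1" "1 \<le> i" "f i = c" "k \<le> d"
    and 2: "\<And>p. p \<le> i \<Longrightarrow> even (i + p) \<Longrightarrow> i \<le> p + 2 * d + 2 \<Longrightarrow> f p = c"
    and 3: "\<And>p. p \<le> i \<Longrightarrow> odd (i + p) \<Longrightarrow> i + 2 * k \<le> p + 2 * d + 1 \<Longrightarrow> f p = y"
    and 4: "\<And>p. p \<le> i \<Longrightarrow> odd (i + p) \<Longrightarrow> i \<le> p + 2 * d + 1 \<Longrightarrow> \<bar>f p - c\<bar> = 1"
    using assms unfolding stateB_def by auto
  have 5: "f (i - 1) = y" using 1 by (intro 3) auto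
  show ?thesis
    unfolding stateA_def
  proof (intro conjI allI impI)
    fix p assume p: "p \<le> Suc i" "odd (Suc i + p) \<and> Suc i \<le> p + 2 * d + 1"
    then show "f p = c" by (cases "p = Suc i") (auto intro: 2)
  next
    fix p assume p: "p \<le> Suc i" "even (Suc i + p) \<and> Suc i + 2 * d \<le> p + 2 * d"
    then have "p = Suc i" by simp
    then show "f p = 2 * c - y" using assms by simp
  next
    fix p assume p: "p \<le> Suc i" "even (Suc i + p) \<and> Suc i \<le> p + 2 * d"
    show "\<bar>f p - c\<bar> = 1"
    proof (cases "p = Suc i")
      case False
      then show ?thesis using p by (intro 4) auto
    qed (use assms(2) 1(1) in \<open>simp add: abs_minus_commute\<close>)
  next
    show "\<exists>p\<le>Suc i. even (Suc i + p) \<and> Suc i + 2 * d = p + 2 * d + 2 \<and> f p = 2 * c - (2 * c - y)"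
      using 1(2) 5 by (intro exI[of _ "i - 1"]) auto
  qed (use 1 assms(2) in \<open>simp_all add: abs_minus_commute\<close>)
qed

text \<open>The vertices tested belong to the oscillating class. If \<open>k = 0\<close>, they all
  carry \<open>y\<close>, and both neighbours of \<open>y\<close> are allowed. If
  \<open>k > 0\<close>, the last occurrence of \<open>2 * c - y\<close>, at distance
  \<open>2 * (d - k) + 2\<close> before \<open>i\<close>, is still tested, and \<open>c\<close> is
  the only common neighbour of \<open>y\<close> and \<open>2 * c - y\<close>.\<close>

lemma step_stateA:
  assumes "stateA f d k c y i" "1 \<le> d"
  shows "step f d i \<longleftrightarrow> f (Suc i) = c \<or> k = 0 \<and> f (Suc i) = 2 * y - c"
proof -
  have 1: "\<bar>y - c\<bar> = 1" "f i = y" "k \<le> d"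
    and 3: "\<And>p. p \<le> i \<Longrightarrow> even (i + p) \<Longrightarrow> i + 2 * k \<le> p + 2 * d \<Longrightarrow> f p = y"
    and 4: "\<And>p. p \<le> i \<Longrightarrow> even (i + p) \<Longrightarrow> i \<le> p + 2 * d \<Longrightarrow> \<bar>f p - c\<bar> = 1"
    and 5: "0 < k \<longrightarrow> (\<exists>p\<le>i. even (i + p) \<and> i + 2 * k = p + 2 * d + 2 \<and> f p = 2 * c - y)"
    using assms unfolding stateA_def by auto
  have y: "step f d i \<Longrightarrow> \<bar>f (Suc i) - y\<bar> = 1"
    unfolding step_def using 1(2) by auto
  show ?thesis
  proof (cases "k = 0")
    case True
    then have "step f d i \<longleftrightarrow> \<bar>f (Suc i) - y\<bar> = 1"
      using y 3 unfolding step_def by auto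
    then show ?thesis using unit_dist_iff[of c y "f (Suc i)"] 1 True by (simp add: abs_minus_commute)
  next
    case False
    then obtain p where p: "p \<le> i" "even (i + p)" "i + 2 * k = p + 2 * d + 2" "f p = 2 * c - y"
      using 5 by auto
    have "f (Suc i) = c" if "step f d i"
    proof -
      have "\<bar>f (Suc i) - f p\<bar> = 1" using that p False unfolding step_def by auto
      then show ?thesis using y[OF that] p(4) 1 by arith
    qed
    moreover have "step f d i" if "f (Suc i) = c"
      using that 4 unfolding step_def by (simp add: abs_minus_commute)
    ultimately show ?thesis using False by auto
  qed
qed

lemma step_stateB:
  assumes "stateB f d k c y i" "1 \<le> d"
  shows "step f d i \<longleftrightarrow> f (Suc i) = y \<or> f (Suc i) = 2 * c - y"
proof -
  have 1: "\<bar>y - c\<bar> = 1" "f i = c"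
    and 2: "\<And>p. p \<le> i \<Longrightarrow> even (i + p) \<Longrightarrow> i \<le> p + 2 * d + 2 \<Longrightarrow> f p = c"
    using assms unfolding stateB_def by auto
  have "step f d i \<longleftrightarrow> \<bar>f (Suc i) - c\<bar> = 1"
    unfolding step_def using 1(2) 2 by auto
  then show ?thesis using unit_dist_iff[OF 1(1)] by simp
qed

lemma steps_iff_acc:
  assumes "1 \<le> d"
  shows "stateA f d k c y i \<Longrightarrow>
      (\<forall>j\<in>{i..<i + m}. step f d j) \<longleftrightarrow> accA d k c y (map f [Suc i..<Suc i + m])"
    and "stateB f d k c y i \<Longrightarrow>
      (\<forall>j\<in>{i..<i + m}. step f d j) \<longleftrightarrow> accB d k c y (map f [Suc i..<Suc i + m])"
proof (induction m arbitrary: i k c y)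
  case (Suc m)
  have split: "(\<forall>j\<in>{i..<i + Suc m}. step f d j) \<longleftrightarrow>
      step f d i \<and> (\<forall>j\<in>{Suc i..<Suc i + m}. step f d j)" for i
    by (auto simp: Ball_def) (metis le_antisym not_less_eq_eq)
  have list: "map f [Suc i..<Suc i + Suc m] = f (Suc i) # map f [Suc (Suc i)..<Suc (Suc i) + m]" for i
    by (subst upt_rec) simp
  { case 1
    let ?Q = "\<forall>j\<in>{Suc i..<Suc i + m}. step f d j"
    let ?L = "map f [Suc (Suc i)..<Suc (Suc i) + m]"
    have "?Q \<longleftrightarrow> accB d k c y ?L" if "f (Suc i) = c"
      by (rule Suc(2), rule stateA_to_B) (fact 1 that)+
    moreover have "?Q \<longleftrightarrow> accA d d y (2 * y - c) ?L" if "k = 0" "f (Suc i) = 2 * y - c"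
      by (rule Suc(1), rule stateA_switch) (use 1 that assms in auto)
    ultimately show ?case
      unfolding split list accA.simps step_stateA[OF 1 assms] by metis
  next
    case 2
    let ?Q = "\<forall>j\<in>{Suc i..<Suc i + m}. step f d j"
    let ?L = "map f [Suc (Suc i)..<Suc (Suc i) + m]"
    have "?Q \<longleftrightarrow> accA d (k - 1) c y ?L" if "f (Suc i) = y"
      by (rule Suc(1), rule stateB_to_A) (fact 2 that assms)+
    moreover have "?Q \<longleftrightarrow> accA d d c (2 * c - y) ?L" if "f (Suc i) = 2 * c - y"
      by (rule Suc(1), rule stateB_jump) (fact 2 that assms)+
    ultimately show ?case
      unfolding split list accB.simps step_stateB[OF 2 assms] by metis }
qed auto

text \<open>Each edge is charged to its larger endpoint.\<close>

lemma P_adj_step: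
  "(\<forall>i j. P_adj n d i j \<longrightarrow> \<bar>f i - f j\<bar> = 1) \<longleftrightarrow> (\<forall>i<n. step f d i)"
proof
  assume L: "\<forall>i j. P_adj n d i j \<longrightarrow> \<bar>f i - f j\<bar> = 1"
  show "\<forall>i<n. step f d i"
    unfolding step_def
  proof (intro allI impI)
    fix i p assume a: "i < n" "p \<le> i" "even (i + p) \<and> i \<le> p + 2 * d"
    then obtain t where t: "i - p = 2 * t" by (metis even_diff_nat dvdE)
    have "P_adj n d (Suc i) p"
      unfolding P_adj_def using a t by (auto intro!: exI[of _ t])
    then show "\<bar>f (Suc i) - f p\<bar> = 1" using L by blast
  qed
next
  assume R: "\<forall>i<n. step f d i"
  have one: "\<bar>f i - f j\<bar> = 1" if "P_adj n d i j" "j < i" for i j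
  proof -
    from that obtain t where t: "int i - int j = 2 * int t + 1" "t \<le> d" "i \<le> n"
      unfolding P_adj_def by auto
    define i' where "i' = i - 1"
    have i: "i = Suc i'" "i' = j + 2 * t" using t that by (auto simp: i'_def)
    have "step f d i'" using R i t by auto
    then show ?thesis using i t(2) unfolding step_def by auto
  qed
  show "\<forall>i j. P_adj n d i j \<longrightarrow> \<bar>f i - f j\<bar> = 1"
  proof (intro allI impI)
    fix i j assume a: "P_adj n d i j"
    then have b: "P_adj n d j i" unfolding P_adj_def by (auto simp: abs_minus_commute)
    have "i \<noteq> j" using a unfolding P_adj_def by auto
    then consider "j < i" | "i < j" by linarith
    then show "\<bar>f i - f j\<bar> = 1"
      using one[OF a] one[OF b] by cases (auto simp: abs_minus_commute)
  qed
qed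

section \<open>Correspondence between homomorphisms and words\<close>

definition tail :: "nat \<Rightarrow> (nat \<Rightarrow> int) \<Rightarrow> int list" where
  "tail n f = map f [2..<Suc n]"

lemma Hom0_iff:
  assumes "1 \<le> n" "1 \<le> d"
  shows "f \<in> Hom0 n d \<longleftrightarrow> f \<in> {0..n} \<rightarrow>\<^sub>E UNIV \<and> f 0 = 0 \<and> \<bar>f 1\<bar> = 1 \<and> acc0 d 0 (f 1) (tail n f)"
proof -
  have "(\<forall>i<n. step f d i) \<longleftrightarrow> \<bar>f 1\<bar> = 1 \<and> acc0 d 0 (f 1) (tail n f)" if "f 0 = 0"
  proof -
    have "(\<forall>i<n. step f d i) \<longleftrightarrow> step f d 0 \<and> (\<forall>i\<in>{1..<1 + (n - 1)}. step f d i)"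
      using assms by (auto simp: Ball_def) (metis One_nat_def Suc_leI neq0_conv)
    moreover have "step f d 0 \<longleftrightarrow> \<bar>f 1\<bar> = 1" using that by (simp add: step_def)
    \<comment> \<open>Up to vertex 1 there is no jump, which is counter 0;
      \<open>acc_zero_eq_acc0\<close> then turns the condition on the word into
      \<open>acc0\<close>.\<close>
    moreover have "stateA f d 0 0 (f 1) 1" if "\<bar>f 1\<bar> = 1"
    proof -
      have "p = 1" if "p \<le> Suc 0" "odd p" for p using that by (cases "p = 0") auto
      moreover have "p = 0" if "p \<le> Suc 0" "even p" for p using that by (cases "p = 0") auto
      ultimately show ?thesis using that \<open>f 0 = 0\<close> unfolding stateA_def by auto
    qed
    ultimately show ?thesis
      using steps_iff_acc(1)[of d f 0 0 "f 1" 1 "n - 1"] assms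
      by (auto simp: acc_zero_eq_acc0 tail_def numeral_2_eq_2)
  qed
  then show ?thesis unfolding Hom0_def P_adj_step by auto
qed

lemma Hom0_range:
  assumes "f \<in> Hom0 n d" "1 \<le> n"
  shows "f ` {0..n} = {0, f 1} \<union> set (tail n f)"
proof -
  have "{0..n} = {0, 1} \<union> {2..n}" using assms by auto
  moreover have "set [2..<Suc n] = {2..n}" by auto
  ultimately show ?thesis using assms by (auto simp: tail_def Hom0_def)
qed

lemma bij_tail:
  assumes "1 \<le> n" "1 \<le> d" "\<bar>s\<bar> = 1"
  shows "bij_betw (tail n) {f \<in> Hom0 n d. f 1 = s} {vs. length vs = n - 1 \<and> acc0 d 0 s vs}"
proof (rule bij_betwI')
  fix f g assume f: "f \<in> {f \<in> Hom0 n d. f 1 = s}" and g: "g \<in> {f \<in> Hom0 n d. f 1 = s}"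
  show "tail n f = tail n g \<longleftrightarrow> f = g"
  proof
    assume *: "tail n f = tail n g"
    show "f = g"
    proof
      fix i
      consider "i = 0" | "i = 1" | "2 \<le> i" "i \<le> n" | "n < i" by linarith
      then show "f i = g i"
      proof cases
        case 3
        then have "i \<in> set [2..<Suc n]" by auto
        then show ?thesis using * by (auto simp: tail_def)
      next
        case 4
        then show ?thesis using f g by (auto simp: Hom0_def PiE_def extensional_def)
      qed (use f g in \<open>auto simp: Hom0_def\<close>)
    qed
  qed simp
next
  fix f assume "f \<in> {f \<in> Hom0 n d. f 1 = s}"
  then show "tail n f \<in> {vs. length vs = n - 1 \<and> acc0 d 0 s vs}"
    using Hom0_iff[OF assms(1,2), of f] by (auto simp: tail_def)
next
  fix vs assume vs: "vs \<in> {vs. length vs = n - 1 \<and> acc0 d 0 s vs}"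
  define f where "f = restrict (\<lambda>i. (0 # s # vs) ! i) {0..n}"
  have t: "tail n f = vs"
    using vs assms
    by (intro nth_equalityI) (auto simp: tail_def f_def nth_Cons' nth_append simp del: upt_Suc)
  have "f 0 = 0" "f 1 = s" using assms by (auto simp: f_def)
  then have "f \<in> Hom0 n d"
    using Hom0_iff[OF assms(1,2), of f] t vs assms by (auto simp: f_def)
  then show "\<exists>f\<in>{f \<in> Hom0 n d. f 1 = s}. vs = tail n f"
    using t \<open>f 1 = s\<close> by auto
qed

lemma card_Hom0_steps0:
  assumes "1 \<le> n" "1 \<le> d" "\<bar>s\<bar> = 1"
  shows "card {f \<in> Hom0 n d. f 1 = s \<and> P (steps0 0 s (tail n f))} = cnt0 d 0 s P (n - 1)"
proof -
  have "bij_betw (tail n) {f \<in> Hom0 n d. f 1 = s \<and> P (steps0 0 s (tail n f))}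
     {vs. length vs = n - 1 \<and> acc0 d 0 s vs \<and> P (steps0 0 s vs)}"
    unfolding bij_betw_def
  proof
    show "inj_on (tail n) {f \<in> Hom0 n d. f 1 = s \<and> P (steps0 0 s (tail n f))}"
      using bij_tail[OF assms] by (auto simp: bij_betw_def intro: inj_on_subset)
    have A: "tail n ` {f \<in> Hom0 n d. f 1 = s} = {vs. length vs = n - 1 \<and> acc0 d 0 s vs}"
      using bij_tail[OF assms] by (simp add: bij_betw_def)
    have "tail n ` {f \<in> Hom0 n d. f 1 = s \<and> P (steps0 0 s (tail n f))} =
        {vs \<in> tail n ` {f \<in> Hom0 n d. f 1 = s}. P (steps0 0 s vs)}"
      by auto
    then show "tail n ` {f \<in> Hom0 n d. f 1 = s \<and> P (steps0 0 s (tail n f))} =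
        {vs. length vs = n - 1 \<and> acc0 d 0 s vs \<and> P (steps0 0 s vs)}"
      unfolding A by simp
  qed
  then show ?thesis unfolding cnt0_def by (rule bij_betw_same_card)
qed

lemma card_Hom0:
  assumes "1 \<le> n" "1 \<le> d"
  shows "card (Hom0 n d) = cnt0 d 0 1 (\<lambda>_. True) (n - 1) + cnt0 d 0 (-1) (\<lambda>_. True) (n - 1)"
proof -
  have "Hom0 n d = {f \<in> Hom0 n d. f 1 = 1} \<union> {f \<in> Hom0 n d. f 1 = -1}"
    using Hom0_iff[OF assms] by auto
  then have "card (Hom0 n d) = card {f \<in> Hom0 n d. f 1 = 1} + card {f \<in> Hom0 n d. f 1 = -1}"
    by (metis (mono_tags, lifting) Hom0_finite card_Un_disjoint disjoint_iff finite_Un mem_Collect_eq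
        one_neq_neg_one)
  then show ?thesis
    using card_Hom0_steps0[OF assms, of 1 "\<lambda>_. True"] card_Hom0_steps0[OF assms, of "-1" "\<lambda>_. True"]
    by simp
qed

text \<open>A function determines \<open>f 1\<close> and its list of centre steps, so the sets
  counted on the left are disjoint, and \<open>steps0_range\<close> places them in the event.
  Functions without a jump and lists outside \<open>E\<close> are left out, hence only an
  inequality.\<close>

lemma card_Hom0_range_ge:
  assumes "1 \<le> n" "1 \<le> d" "finite E" "\<And>es. es \<in> E \<Longrightarrow> R (card (centres 0 es) + 2)"
  shows "(\<Sum>es\<in>E. cnt0 d 0 1 ((=) (Some es)) (n - 1) + cnt0 d 0 (-1) ((=) (Some es)) (n - 1))
    \<le> card {f \<in> Hom0 n d. R (card (f ` {0..n}))}"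
proof -
  let ?H = "\<lambda>(s, es). {f \<in> Hom0 n d. f 1 = s \<and> Some es = steps0 0 s (tail n f)}"
  have "(\<Sum>es\<in>E. cnt0 d 0 1 ((=) (Some es)) (n - 1) + cnt0 d 0 (-1) ((=) (Some es)) (n - 1)) =
      (\<Sum>es\<in>E. card (?H (1, es)) + card (?H (-1, es)))"
    using card_Hom0_steps0[OF assms(1,2), of 1] card_Hom0_steps0[OF assms(1,2), of "-1"] by simp
  also have "\<dots> = (\<Sum>x\<in>{1, -1} \<times> E. card (?H x))"
  proof -
    have "(\<Sum>x\<in>{1, -1} \<times> E. card (?H x)) = (\<Sum>s\<in>{1, -1}. \<Sum>es\<in>E. card (?H (s, es)))"
      by (subst sum.cartesian_product) (auto intro!: sum.cong)
    then show ?thesis by (simp add: sum.distrib)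
  qed
  also have "\<dots> = card (\<Union>x\<in>{1, -1} \<times> E. ?H x)"
  proof (rule card_UN_disjoint[symmetric])
    show "\<forall>x\<in>{1, -1} \<times> E. finite (?H x)"
      by (auto intro: finite_subset[OF _ Hom0_finite])
    show "\<forall>x\<in>{1, -1} \<times> E. \<forall>x'\<in>{1, -1} \<times> E. x \<noteq> x' \<longrightarrow> ?H x \<inter> ?H x' = {}"
    proof (intro ballI impI)
      fix x x' :: "int \<times> int list" assume "x \<noteq> x'"
      have "x = (f 1, the (steps0 0 (f 1) (tail n f)))" if "f \<in> ?H x" for f x
        using that by (cases x) (auto dest: arg_cong[of _ _ the])
      with \<open>x \<noteq> x'\<close> show "?H x \<inter> ?H x' = {}" by blast
    qed
  qed (use assms(3) in simp)
  also have "\<dots> \<le> card {f \<in> Hom0 n d. R (card (f ` {0..n}))}"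
  proof (intro card_mono)
    show "(\<Union>x\<in>{1, -1} \<times> E. ?H x) \<subseteq> {f \<in> Hom0 n d. R (card (f ` {0..n}))}"
    proof clarsimp
      fix s es f
      assume a: "s = 1 \<or> s = -1" "es \<in> E" "f \<in> Hom0 n d" "Some es = steps0 0 (f (Suc 0)) (tail n f)"
      have "card ({0, f 1} \<union> set (tail n f)) = card (centres 0 es) + 2"
        using a Hom0_iff[OF assms(1,2), of f] by (intro steps0_range[of d]) auto
      then have "card (f ` {0..n}) = card (centres 0 es) + 2"
        using Hom0_range[OF a(3) assms(1)] by simp
      then show "R (card (f ` {0..n}))" using assms(4)[OF a(2)] by simp
    qed
  qed (auto intro: finite_subset[OF _ Hom0_finite])
  finally show ?thesis .
qed

section \<open>Bounds on the number of accepted words\<close>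

text \<open>This is \<open>cnt_rec\<close> with the switch term dropped. Two vertices are paid to
  remove the dependence on the starting value \<open>y\<close>.\<close>

lemma cnt_centre_le:
  assumes "0 < d" "\<bar>y - c\<bar> = 1"
  shows "cnt d c (c + 1) P m + cnt d c (c - 1) P m \<le> cnt d c y P (Suc (Suc m))"
proof -
  have eq: "2 * c - (c + 1) = c - 1" "2 * c - (c - 1) = c + 1" by simp_all
  have "y = c + 1 \<or> y = c - 1" using assms(2) by arith
  then show ?thesis
    using cnt_rec[of c "c + 1" d P m, unfolded eq] cnt_rec[of c "c - 1" d P m, unfolded eq] assms(1)
    by auto
qed

text \<open>For the list \<open>e # es\<close>, the sum over both starting values at
  \<open>m + 2 * d + 3\<close> is at least twice that sum at \<open>m + 2 * d + 1\<close> plus the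
  corresponding sum for \<open>es\<close> at \<open>m\<close>: the entry \<open>e\<close> selects
  one of the two switch terms, and \<open>cnt_centre_le\<close> restores the sum over both values
  after the switch. Up to powers of 2 this is Pascal's recursion, where each centre step consumes
  \<open>2 * d + 3\<close> vertices. The leftover parity is \<open>i\<close>.\<close>

lemma cnt_both_lower:
  assumes "0 < d" "set es \<subseteq> {-1, 1}" "i \<le> 1"
  shows "2 ^ Suc y * ((y + length es) choose length es)
    \<le> cnt d c (c + 1) ((=) es) (length es * (2 * d + 3) + 2 * y + i)
      + cnt d c (c - 1) ((=) es) (length es * (2 * d + 3) + 2 * y + i)"
  using assms(2)
proof (induction es arbitrary: c y)
  case Nil
  have i: "i = 0 \<or> i = Suc 0" using assms(3) by auto
  show ?case
  proof (induction y)
    case 0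
    then show ?case using i by (auto simp: cnt_1 assms)
  next
    case (Suc y)
    have "2 * Suc y + i = Suc (Suc (2 * y + i))" by simp
    then show ?case using Suc by (simp add: cnt_rec assms del: mult_Suc_right)
  qed
next
  case (Cons e es)
  let ?r = "length es" and ?D = "2 * d + 3"
  let ?v = "\<lambda>m. cnt d c (c + 1) ((=) (e # es)) m + cnt d c (c - 1) ((=) (e # es)) m"
  have e: "e = 1 \<or> e = -1" and es: "set es \<subseteq> {-1, 1}" using Cons.prems by auto
  have step: "2 * ?v (m + 2 * d + 1) + (cnt d (c + e) (c + e + 1) ((=) es) m
      + cnt d (c + e) (c + e - 1) ((=) es) m) \<le> ?v (m + 2 * d + 3)" for m
  proof -
    have m: "m + 2 * d + 3 = Suc (Suc (m + 2 * d + 1))" by simp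
    have d: "m + 2 * d + 1 - (2 * d - 1) = Suc (Suc m)" "\<not> m + 2 * d + 1 < 2 * d - 1"
      using assms(1) by auto
    have sw: "cnt d (c + e) (c + e + 1) ((=) es) m + cnt d (c + e) (c + e - 1) ((=) es) m
        \<le> cnt d (c + e) (c + 2 * e) ((=) es) (Suc (Suc m))"
      using e by (intro cnt_centre_le assms(1)) auto
    have "?v (m + 2 * d + 3) = 2 * ?v (m + 2 * d + 1)
        + cnt d (c + 1) (c + 2) (\<lambda>t. e # es = 1 # t) (Suc (Suc m))
        + cnt d (c - 1) (c - 2) (\<lambda>t. e # es = -1 # t) (Suc (Suc m))"
      unfolding m
      by (subst cnt_rec; use assms(1) in simp)
         (subst cnt_rec; use assms(1) d in simp)
    moreover have "cnt d (c + e) (c + 2 * e) ((=) es) (Suc (Suc m))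
        \<le> cnt d (c + 1) (c + 2) (\<lambda>t. e # es = 1 # t) (Suc (Suc m))
          + cnt d (c - 1) (c - 2) (\<lambda>t. e # es = -1 # t) (Suc (Suc m))"
      using e by (elim disjE) (simp_all del: cntA_0)
    ultimately show ?thesis using sw by linarith
  qed
  show ?case
  proof (induction y)
    case 0
    show ?case
      using step[of "?r * ?D + i"] Cons.IH[OF es, of 0 "c + e"] by (simp add: algebra_simps)
  next
    case (Suc y)
    have eq: "length (e # es) * ?D + 2 * Suc y + i = (?r * ?D + 2 * Suc y + i) + 2 * d + 3"
      "length (e # es) * ?D + 2 * y + i = (?r * ?D + 2 * Suc y + i) + 2 * d + 1"
      by simp_all
    have "2 ^ Suc (Suc y) * ((Suc y + length (e # es)) choose length (e # es)) =
        2 * (2 ^ Suc y * ((y + length (e # es)) choose length (e # es)))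
        + 2 ^ Suc (Suc y) * ((Suc y + ?r) choose ?r)"
      by (simp add: algebra_simps)
    also have "\<dots> \<le> ?v ((?r * ?D + 2 * Suc y + i) + 2 * d + 3)"
      using add_mono[OF mult_le_mono2[OF Suc[unfolded eq(2)], of 2]
          Cons.IH[OF es, of "Suc y" "c + e"]] step[of "?r * ?D + 2 * Suc y + i"]
      by (rule order_trans)
    finally show ?case unfolding eq .
  qed
qed

lemma cnt_lower:
  assumes "0 < d" "set es \<subseteq> {-1, 1}" "i \<le> 1" "\<bar>y - c\<bar> = 1"
  shows "2 ^ Suc q * ((q + length es) choose length es)
    \<le> cnt d c y ((=) es) (length es * (2 * d + 3) + 2 * Suc q + i)"
proof -
  have "2 ^ Suc q * ((q + length es) choose length es)
      \<le> cnt d c y ((=) es) (Suc (Suc (length es * (2 * d + 3) + 2 * q + i)))"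
    using cnt_both_lower[OF assms(1-3), of q c] cnt_centre_le[OF assms(1,4)]
    by (rule order_trans)
  then show ?thesis by simp
qed

text \<open>Unrolling \<open>cnt0_Suc\<close> sorts the words by their first jump, after which some
  \<open>m < k\<close> letters remain.\<close>

lemma cnt0_lower:
  assumes "\<And>m c y. \<bar>y - c\<bar> = 1 \<Longrightarrow> m < k \<Longrightarrow> B m \<le> cnt d c y (\<lambda>es. P (Some es)) m" "\<bar>y - x\<bar> = 1"
  shows "(\<Sum>m<k. B m) \<le> cnt0 d x y P k"
  using assms
proof (induction k arbitrary: x y)
  case (Suc k)
  have "\<bar>x - y\<bar> = 1" "\<bar>(2 * y - x) - y\<bar> = 1" "x \<noteq> y" using Suc.prems(2) by auto
  moreover have "(\<Sum>m<k. B m) \<le> cnt0 d y x P k"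
    using calculation by (intro Suc.IH Suc.prems(1)) auto
  moreover have "B k \<le> cnt d y (2 * y - x) (\<lambda>es. P (Some es)) k"
    using calculation by (intro Suc.prems(1)) auto
  ultimately show ?case by (simp add: cnt0_Suc)
qed simp

text \<open>The same unrolling; the summand 1 accounts for the single word without a jump.\<close>

lemma cnt0_upper:
  assumes "\<And>m c y. \<bar>y - c\<bar> = 1 \<Longrightarrow> m < k \<Longrightarrow> real (cnt d c y (\<lambda>es. P (Some es)) m) \<le> B m" "\<bar>y - x\<bar> = 1"
  shows "real (cnt0 d x y P k) \<le> 1 + (\<Sum>m<k. B m)"
  using assms
proof (induction k arbitrary: x y)
  case (Suc k)
  have "\<bar>x - y\<bar> = 1" "\<bar>(2 * y - x) - y\<bar> = 1" "x \<noteq> y" using Suc.prems(2) by auto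
  moreover have "real (cnt0 d y x P k) \<le> 1 + (\<Sum>m<k. B m)"
    using calculation by (intro Suc.IH Suc.prems(1)) auto
  moreover have "real (cnt d y (2 * y - x) (\<lambda>es. P (Some es)) k) \<le> B k"
    using calculation by (intro Suc.prems(1)) auto
  ultimately show ?case by (simp add: cnt0_Suc)
qed simp

text \<open>The parity-dependent constant in the sums of \<open>2 ^ (l div 2)\<close>. The ratio
  \<open>par 0 / par 1 = 3 / (2 * sqrt 2)\<close> becomes the bias of the limit law.\<close>

definition par :: "nat \<Rightarrow> real" where
  "par n = (if even n then 6 else 4 * sqrt 2)"

lemma sum_half_powers: "(\<Sum>l<T. 2 ^ (l div 2) :: real) = sqrt 2 ^ T * par (Suc T) / (2 * sqrt 2) - 2"
proof (induction T)
  case (Suc T)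
  have s: "sqrt 2 ^ (2 * q) = (2::real) ^ q" for q
    by (simp add: power_mult)
  show ?case
  proof (cases "even T")
    case True
    then obtain q where q: "T = 2 * q" by blast
    then show ?thesis using Suc by (simp add: par_def s)
  next
    case False
    then obtain q where q: "T = 2 * q + 1" by (metis oddE)
    then show ?thesis using Suc by (simp add: par_def s)
  qed
qed (simp add: par_def)

lemma power_over_fact_le_choose: "real N ^ r / fact r \<le> real ((N + r) choose r)"
proof -
  have "real N ^ r \<le> (\<Prod>i<r. real N + real i + 1)"
    using prod_mono[of "{..<r}" "\<lambda>_. real N" "\<lambda>i. real N + real i + 1"] by simp
  also have "\<dots> = fact r * real ((N + r) choose r)"
  proof (induction r)
    case (Suc r)
    have "real (Suc r) * real ((N + Suc r) choose Suc r) = (real N + real r + 1) * real ((N + r) choose r)"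
      using Suc_times_binomial_eq[of "N + r" r] by (simp flip: of_nat_mult add: algebra_simps)
    then have "fact (Suc r) * real ((N + Suc r) choose Suc r) =
        fact r * real ((N + r) choose r) * (real N + real r + 1)"
      by (simp add: mult.assoc mult.commute mult.left_commute)
    then show ?case using Suc by simp
  qed simp
  finally show ?thesis by (simp add: field_simps)
qed

text \<open>The list uses up \<open>D\<close> vertices. Words with fewer than
  \<open>D + 2 * N + 2\<close> letters after the first jump are dropped; for the others the binomial
  coefficient is at least \<open>(N + r) choose r\<close>, which becomes a common factor. The powers
  \<open>2 ^ (l div 2)\<close> remain to be summed, and the cut-off causes the error
  \<open>2 ^ (N + 2)\<close>.\<close>

lemma cnt0_pattern_lower:
  fixes d n :: nat and es :: "int list"
  defines "r \<equiv> length es"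
  defines "D \<equiv> r * (2 * d + 3)"
  assumes "0 < d" "set es \<subseteq> {-1, 1}" "\<bar>s\<bar> = 1" "D + 2 * N + 3 \<le> n"
  shows "real N ^ r / fact r * (sqrt 2 ^ (n - D) * par (n + r) / 4 - 2 ^ (N + 2))
    \<le> real (cnt0 d 0 s ((=) (Some es)) (n - 1))"
proof -
  define a where "a = D + 2 * N + 2"
  define B where "B m = (if a \<le> m then 2 ^ ((m - D) div 2) * ((N + r) choose r) else 0)" for m
  have "B m \<le> cnt d c y ((=) es) m" if y: "\<bar>y - c\<bar> = 1" for m c y
  proof (cases "a \<le> m")
    case True
    define q where "q = (m - D) div 2 - 1"
    define i where "i = (m - D) mod 2"
    have m: "m = D + 2 * Suc q + i" "(m - D) div 2 = Suc q" "N \<le> q"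
      using True unfolding a_def q_def i_def by (auto simp: algebra_simps)
    have "i \<le> 1" unfolding i_def by auto
    have "B m = 2 ^ Suc q * ((N + r) choose r)" using True m by (simp add: B_def)
    also have "\<dots> \<le> 2 ^ Suc q * ((q + r) choose r)"
      using m(3) by (intro mult_left_mono binomial_right_mono) auto
    also have "\<dots> \<le> cnt d c y ((=) es) m"
      using cnt_lower[OF assms(3,4) \<open>i \<le> 1\<close> y, of q] m(1) by (simp add: r_def D_def)
    finally show ?thesis .
  qed (simp add: B_def)
  then have "(\<Sum>m<n - 1. B m) \<le> cnt0 d 0 s ((=) (Some es)) (n - 1)"
    using assms(5) by (intro cnt0_lower) auto
  moreover have "real (\<Sum>m<n - 1. B m) =
      real ((N + r) choose r) * (sqrt 2 ^ (n - D) * par (n + r) / 4 - 2 ^ (N + 2))"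
  proof -
    define T where "T = n - 1 - a"
    have n: "n - 1 = T + a" using assms(6) by (simp add: T_def a_def)
    have "real (\<Sum>m<n - 1. B m) = (\<Sum>m\<in>{a..<n - 1}. real (B m))"
      unfolding of_nat_sum by (intro sum.mono_neutral_right) (auto simp: B_def)
    also have "\<dots> = (\<Sum>l<T. real (B (l + a)))"
      using sum.shift_bounds_nat_ivl[of "\<lambda>m. real (B m)" 0 a T] n
      by (simp add: lessThan_atLeast0)
    also have "\<dots> = (\<Sum>l<T. real ((N + r) choose r) * 2 ^ (N + 1) * 2 ^ (l div 2))"
    proof (intro sum.cong refl)
      fix l
      have "(l + a - D) div 2 = N + 1 + l div 2" by (simp add: a_def)
      then show "real (B (l + a)) = real ((N + r) choose r) * 2 ^ (N + 1) * 2 ^ (l div 2)"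
        by (simp add: B_def power_add)
    qed
    also have "\<dots> = real ((N + r) choose r) * (2 ^ (N + 1) * (\<Sum>l<T. 2 ^ (l div 2)))"
      by (simp add: sum_distrib_left mult.assoc)
    also have "2 ^ (N + 1) * (\<Sum>l<T. 2 ^ (l div 2)) =
        sqrt 2 ^ (n - D) * par (n + r) / 4 - 2 ^ (N + 2)"
    proof -
      have "n - D = T + 2 * (N + 1) + 1" using n assms(6) by (simp add: a_def)
      then have "sqrt 2 ^ (n - D) = sqrt 2 ^ T * 2 ^ (N + 1) * sqrt 2"
        by (simp add: power_add power_mult)
      \<comment> \<open>The point is that \<open>D + r = r * (2 * d + 4)\<close> is even.\<close>
      moreover have "even (n + r) \<longleftrightarrow> even (Suc T)"
      proof -
        have "n + r = Suc T + (2 * N + 2) + (D + r)" using n assms(6) by (simp add: a_def)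
        moreover have "even (D + r)" by (simp add: D_def)
        ultimately show ?thesis by presburger
      qed
      then have "par (n + r) = par (Suc T)" by (simp add: par_def)
      moreover have "1 / (2 * sqrt 2) = sqrt 2 / (4::real)" by (simp add: field_simps)
      ultimately show ?thesis
        unfolding sum_half_powers by (simp add: field_simps)
    qed
    finally show ?thesis .
  qed
  ultimately have choose: "real ((N + r) choose r) * (sqrt 2 ^ (n - D) * par (n + r) / 4 - 2 ^ (N + 2))
      \<le> real (cnt0 d 0 s ((=) (Some es)) (n - 1))"
    by (metis of_nat_le_iff)
  \<comment> \<open>The binomial coefficient may be replaced by its lower bound if the bracket is
    nonnegative; otherwise the claimed bound is at most 0.\<close>
  show ?thesis
  proof (cases "0 \<le> sqrt 2 ^ (n - D) * par (n + r) / 4 - 2 ^ (N + 2)")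
    case True
    from order_trans[OF mult_right_mono[OF power_over_fact_le_choose True] choose] show ?thesis .
  next
    case False
    then have "real N ^ r / fact r * (sqrt 2 ^ (n - D) * par (n + r) / 4 - 2 ^ (N + 2)) \<le> 0"
      by (intro mult_nonneg_nonpos) auto
    then show ?thesis by (rule order_trans) simp
  qed
qed

section \<open>Upper bound for the total number of words\<close>

definition grow :: "nat \<Rightarrow> real \<Rightarrow> real" where
  "grow m x = (if even m then 2 * cosh x + sqrt 2 * sinh x else sqrt 2 * cosh x + 2 * sinh x)"

lemma self_le_sinh:
  fixes h :: real
  assumes "0 \<le> h"
  shows "h \<le> sinh h"
proof -
  have "sinh 0 - 0 \<le> sinh h - h"
  proof (rule DERIV_nonneg_imp_nondecreasing[OF assms])
    fix x :: real
    show "\<exists>y. ((\<lambda>h. sinh h - h) has_real_derivative y) (at x) \<and> 0 \<le> y"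
      by (intro exI[of _ "cosh x - 1"] conjI) (auto intro!: derivative_eq_intros simp: cosh_real_ge_1)
  qed
  then show ?thesis by simp
qed

text \<open>\<open>grow (Suc m)\<close> is the derivative of \<open>grow m\<close>, and the left
  side is one Euler step. It stays below the exact value by the addition formulas, since
  \<open>cosh h \<ge> 1\<close> and \<open>sinh h \<ge> h\<close>.\<close>

lemma grow_step:
  assumes "0 \<le> x" "0 \<le> h"
  shows "grow m x + h * grow (Suc m) x \<le> grow m (x + h)"
proof -
  have c: "cosh x + h * sinh x \<le> cosh (x + h)"
  proof -
    have "1 * cosh x + h * sinh x \<le> cosh h * cosh x + sinh h * sinh x"
      using assms self_le_sinh
      by (intro add_mono mult_right_mono) (auto simp: cosh_real_ge_1 cosh_real_nonneg)
    then show ?thesis by (simp add: cosh_add algebra_simps)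
  qed
  have s: "sinh x + h * cosh x \<le> sinh (x + h)"
  proof -
    have "1 * sinh x + h * cosh x \<le> cosh h * sinh x + sinh h * cosh x"
      using assms self_le_sinh
      by (intro add_mono mult_right_mono) (auto simp: cosh_real_ge_1 cosh_real_nonneg)
    then show ?thesis by (simp add: sinh_add algebra_simps)
  qed
  have "2 * (cosh x + h * sinh x) + sqrt 2 * (sinh x + h * cosh x) \<le> 2 * cosh (x + h) + sqrt 2 * sinh (x + h)"
    "sqrt 2 * (cosh x + h * sinh x) + 2 * (sinh x + h * cosh x) \<le> sqrt 2 * cosh (x + h) + 2 * sinh (x + h)"
    using c s by (intro add_mono mult_left_mono; simp)+
  then show ?thesis by (simp add: grow_def algebra_simps)
qed

lemma grow_nonneg: "0 \<le> x \<Longrightarrow> 0 \<le> grow m x"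
  by (auto simp: grow_def cosh_real_nonneg)

lemma grow_mono: "0 \<le> x \<Longrightarrow> x \<le> x' \<Longrightarrow> grow m x \<le> grow m x'"
  using grow_step[of x "x' - x" m] grow_nonneg[of x "Suc m"]
  by (smt (verit) mult_nonneg_nonneg)

text \<open>After division by \<open>sqrt 2 ^ m / 2\<close>, \<open>cnt_rec\<close> is dominated by
  an Euler scheme for \<open>grow\<close> with step \<open>h = 1 / (sqrt 2 * 2 ^ d)\<close> per two
  vertices, so \<open>grow_step\<close> closes the induction.\<close>

lemma cnt_upper:
  assumes "0 < d" "y \<noteq> c"
  shows "real (cnt d c y (\<lambda>_. True) m) \<le> sqrt 2 ^ m / 2 * grow m (real m / (2 * sqrt 2 * 2 ^ d))"
  using assms(2)
proof (induction m arbitrary: c y rule: less_induct)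
  case (less m)
  define h :: real where "h = 1 / (sqrt 2 * 2 ^ d)"
  define F where "F m = sqrt 2 ^ m / 2 * grow m (h * real m / 2)" for m
  have h: "0 \<le> h" by (simp add: h_def)
  have IH: "real (cnt d c y (\<lambda>_. True) l) \<le> F l" if "l < m" "y \<noteq> c" for l c y
    using less.IH[OF that] by (simp add: F_def h_def field_simps)
  consider "m = 0" | "m = 1" | l where "m = Suc (Suc l)"
    by (metis One_nat_def not0_implies_Suc)
  then have "real (cnt d c y (\<lambda>_. True) m) \<le> F m"
  proof cases
    case 1
    then show ?thesis by (simp add: F_def grow_def)
  next
    case 2
    have "sqrt 2 * 1 \<le> grow 1 (h / 2)"
      unfolding grow_def using h cosh_real_ge_1[of "h / 2"]
      by (simp add: add_increasing2)
    then have "sqrt 2 / 2 * (sqrt 2 * 1) \<le> sqrt 2 / 2 * grow 1 (h / 2)"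
      by (intro mult_left_mono) auto
    then show ?thesis using 2 less.prems assms(1) by (simp add: cnt_1 F_def)
  next
    case 3
    have x: "0 \<le> h * real l / 2" using h by simp
    have sw: "real (if l < 2 * d - 1 then 0 else cnt d y (2 * y - c) (\<lambda>es. True) (l - (2 * d - 1)))
        \<le> sqrt 2 ^ Suc (Suc l) / 2 * (h * grow (Suc l) (h * real l / 2))"
    proof (cases "l < 2 * d - 1")
      case False
      define p where "p = l - (2 * d - 1)"
      have l: "l = p + 2 * d - 1" using False assms(1) by (simp add: p_def)
      have "real (cnt d y (2 * y - c) (\<lambda>es. True) p) \<le> F p"
        using less.prems 3 l assms(1) by (intro IH) auto
      \<comment> \<open>\<open>p\<close> has the parity of \<open>Suc l\<close>, the only property
        of the index that \<open>grow\<close> sees. The shift of the argument from \<open>p\<close>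
        to \<open>l\<close> is then given away by monotonicity.\<close>
      also have "\<dots> = sqrt 2 ^ p / 2 * grow (Suc l) (h * real p / 2)"
        using l assms(1) by (simp add: F_def grow_def)
      also have "\<dots> \<le> sqrt 2 ^ p / 2 * grow (Suc l) (h * real l / 2)"
        using h l assms(1) by (intro mult_left_mono grow_mono divide_right_mono) auto
      \<comment> \<open>The \<open>2 * d + 1\<close> vertices consumed by a switch cost the factor
        \<open>sqrt 2 ^ (2 * d + 1) = 1 / h\<close>.\<close>
      also have "sqrt 2 ^ p = sqrt 2 ^ Suc (Suc l) * h"
      proof -
        have "Suc (Suc l) = p + 2 * d + 1" using l assms(1) by simp
        then have "sqrt 2 ^ Suc (Suc l) = sqrt 2 ^ p * (2 ^ d * sqrt 2)"
          by (simp add: power_add power_mult)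
        then show ?thesis by (simp add: h_def)
      qed
      finally show ?thesis using False by (simp add: p_def mult.assoc)
    qed (use h x grow_nonneg in simp)
    have "real (cnt d c y (\<lambda>_. True) m) \<le>
        F l + F l + sqrt 2 ^ Suc (Suc l) / 2 * (h * grow (Suc l) (h * real l / 2))"
      using cnt_rec[of c y d "\<lambda>_. True" l] IH[of l y c] IH[of l "2 * c - y" c] sw less.prems assms(1) 3
      by simp
    also have "\<dots> = sqrt 2 ^ m / 2 * (grow l (h * real l / 2) + h * grow (Suc l) (h * real l / 2))"
      by (simp add: F_def 3 algebra_simps)
    also have "\<dots> \<le> sqrt 2 ^ m / 2 * grow l (h * real l / 2 + h)"
      using grow_step[OF x h] by (intro mult_left_mono) auto
    also have "\<dots> = F m" by (simp add: F_def 3 grow_def field_simps)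
    finally show ?thesis .
  qed
  then show ?case by (simp add: F_def h_def field_simps)
qed

text \<open>From \<open>k\<close> to \<open>Suc k\<close> the right side grows by exactly the
  \<open>k\<close>-th summand, so only its nonnegative value at 0 is lost.\<close>

lemma sum_grow:
  "(\<Sum>m<k. sqrt 2 ^ m / 2 * grow m x) \<le>
     sqrt 2 ^ k / (2 * sqrt 2) * (par (Suc k) * cosh x + par k * sinh x)" if "0 \<le> x"
proof (induction k)
  case 0
  then show ?case using that by (simp add: par_def cosh_real_nonneg)
next
  case (Suc k)
  have "sqrt 2 ^ k / (2 * sqrt 2) * (par (Suc k) * cosh x + par k * sinh x) + sqrt 2 ^ k / 2 * grow k x
      = sqrt 2 ^ Suc k / (2 * sqrt 2) * (par (Suc (Suc k)) * cosh x + par (Suc k) * sinh x)"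
    by (simp add: par_def grow_def field_simps)
  then show ?case using Suc by simp
qed

text \<open>Up to the factor \<open>par (Suc n)\<close>, the bracket is the normalising constant of
  a parity-biased Poisson law with bias \<open>par n / par (Suc n)\<close>. Hence the lower bounds
  for single lists add up to 1 in the limit.\<close>

lemma cnt0_total_upper:
  assumes "0 < d" "1 \<le> n" "\<bar>s\<bar> = 1"
  defines "x \<equiv> real n / (2 * sqrt 2 * 2 ^ d)"
  shows "real (cnt0 d 0 s (\<lambda>_. True) (n - 1)) \<le> 1 + sqrt 2 ^ n / 4 * (par n * cosh x + par (Suc n) * sinh x)"
proof -
  have x: "0 \<le> x" by (simp add: x_def)
  have "real (cnt0 d 0 s (\<lambda>_. True) (n - 1)) \<le> 1 + (\<Sum>m<n - 1. sqrt 2 ^ m / 2 * grow m x)"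
  proof (rule cnt0_upper)
    fix m c y assume "\<bar>y - c\<bar> = (1::int)" "m < n - 1"
    then have "real (cnt d c y (\<lambda>_. True) m) \<le> sqrt 2 ^ m / 2 * grow m (real m / (2 * sqrt 2 * 2 ^ d))"
      using assms(1) by (intro cnt_upper) auto
    also have "\<dots> \<le> sqrt 2 ^ m / 2 * grow m x"
      unfolding x_def using \<open>m < n - 1\<close>
      by (intro mult_left_mono grow_mono divide_right_mono) auto
    finally show "real (cnt d c y (\<lambda>_. True) m) \<le> sqrt 2 ^ m / 2 * grow m x" .
  qed (use assms in simp)
  also have "\<dots> \<le> 1 + sqrt 2 ^ (n - 1) / (2 * sqrt 2) * (par n * cosh x + par (n - 1) * sinh x)"
    using sum_grow[OF x, of "n - 1"] assms(2) by simp
  also have "sqrt 2 ^ (n - 1) / (2 * sqrt 2) = sqrt 2 ^ n / (4::real)"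
    using assms(2) by (cases n) (auto simp: field_simps)
  also have "par (n - 1) = par (Suc n)" using assms(2) by (auto simp: par_def)
  finally show ?thesis .
qed

section \<open>The limit law\<close>

lemma measure_pmf_nat_sums:
  "(\<lambda>n. if n \<in> A then pmf p n else 0) sums measure (measure_pmf p) A" for p :: "nat pmf"
proof -
  have "(\<lambda>n. measure (measure_pmf p) (if n \<in> A then {n} else {})) sums
      measure (measure_pmf p) (\<Union>n. if n \<in> A then {n} else {})"
    by (intro measure_pmf.finite_measure_UNION) (auto simp: disjoint_family_on_def)
  moreover have "(\<Union>n. if n \<in> A then {n} else {}) = A" by (auto split: if_splits)
  moreover have "measure (measure_pmf p) (if n \<in> A then {n} else {}) = (if n \<in> A then pmf p n else 0)" for n
    by (simp add: measure_pmf_single)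
  ultimately show ?thesis by simp
qed

text \<open>The even and odd parts of the exponential series are \<open>cosh\<close> and
  \<open>sinh\<close>.\<close>

lemma measure_poisson_parity:
  assumes "0 < \<kappa>"
  shows "measure (measure_pmf (poisson_pmf \<kappa>)) {r. even r} = exp (- \<kappa>) * cosh \<kappa>"
    and "measure (measure_pmf (poisson_pmf \<kappa>)) {r. odd r} = exp (- \<kappa>) * sinh \<kappa>"
proof -
  have "(\<lambda>n. exp (- \<kappa>) * (if even n then \<kappa> ^ n /\<^sub>R fact n else 0)) sums (exp (- \<kappa>) * cosh \<kappa>)"
    by (intro sums_mult cosh_converges)
  also have "(\<lambda>n. exp (- \<kappa>) * (if even n then \<kappa> ^ n /\<^sub>R fact n else 0)) =
      (\<lambda>n. if n \<in> {r. even r} then pmf (poisson_pmf \<kappa>) n else 0)"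
    using assms by (auto simp: fun_eq_iff divide_inverse)
  finally show "measure (measure_pmf (poisson_pmf \<kappa>)) {r. even r} = exp (- \<kappa>) * cosh \<kappa>"
    using measure_pmf_nat_sums sums_unique2 by blast
  have "(\<lambda>n. exp (- \<kappa>) * (if even n then 0 else \<kappa> ^ n /\<^sub>R fact n)) sums (exp (- \<kappa>) * sinh \<kappa>)"
    by (intro sums_mult sinh_converges)
  also have "(\<lambda>n. exp (- \<kappa>) * (if even n then 0 else \<kappa> ^ n /\<^sub>R fact n)) =
      (\<lambda>n. if n \<in> {r. odd r} then pmf (poisson_pmf \<kappa>) n else 0)"
    using assms by (auto simp: fun_eq_iff divide_inverse)
  finally show "measure (measure_pmf (poisson_pmf \<kappa>)) {r. odd r} = exp (- \<kappa>) * sinh \<kappa>"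
    using measure_pmf_nat_sums sums_unique2 by blast
qed

text \<open>The weight \<open>tanh \<kappa>\<close> is the quotient of the normalising constants of
  the odd and the even law, so both parts of the mixture share one denominator.\<close>

lemma pmf_parity_biased_poisson:
  assumes "0 < \<kappa>" "0 < \<alpha>"
  shows "pmf (parity_biased_poisson \<kappa> \<alpha>) r =
    (if even r then \<alpha> else 1) * (\<kappa> ^ r / fact r) / (\<alpha> * cosh \<kappa> + sinh \<kappa>)"
proof -
  define T where "T = tanh \<kappa>"
  have "0 < T" using assms by (simp add: T_def)
  then have T: "0 < T" "0 < \<alpha> + T" "\<alpha> + T \<noteq> 0" using assms(2) by auto
  have c: "0 < cosh \<kappa>" by (simp add: cosh_real_pos)
  have s: "sinh \<kappa> = T * cosh \<kappa>" using c by (simp add: T_def tanh_def)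
  have ne: "set_pmf (poisson_pmf \<kappa>) \<inter> {r. even r} \<noteq> {}" "set_pmf (poisson_pmf \<kappa>) \<inter> {r. odd r} \<noteq> {}"
    using assms by (auto simp: set_pmf_poisson intro: exI[of _ "1::nat"] exI[of _ "0::nat"])
  have e: "pmf (poisson_even_pmf \<kappa>) r = (if even r then \<kappa> ^ r / fact r / cosh \<kappa> else 0)"
    using assms c by (simp add: poisson_even_pmf_def pmf_cond[OF ne(1)] measure_poisson_parity)
  have o: "pmf (poisson_odd_pmf \<kappa>) r = (if odd r then \<kappa> ^ r / fact r / (T * cosh \<kappa>) else 0)"
    using assms by (simp add: poisson_odd_pmf_def pmf_cond[OF ne(2)] measure_poisson_parity s)
  have "0 \<le> \<alpha> / (\<alpha> + T)" "\<alpha> / (\<alpha> + T) \<le> 1" using assms T(1) by auto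
  then have "pmf (parity_biased_poisson \<kappa> \<alpha>) r =
      \<alpha> / (\<alpha> + T) * pmf (poisson_even_pmf \<kappa>) r + (1 - \<alpha> / (\<alpha> + T)) * pmf (poisson_odd_pmf \<kappa>) r"
    by (simp add: parity_biased_poisson_def pmf_bind flip: T_def)
  also have "1 - \<alpha> / (\<alpha> + T) = T / (\<alpha> + T)"
    using T by (simp add: field_simps)
  finally have "pmf (parity_biased_poisson \<kappa> \<alpha>) r =
      (if even r then \<alpha> else 1) * (\<kappa> ^ r / fact r) / ((\<alpha> + T) * cosh \<kappa>)"
    using T c by (cases "even r") (simp_all add: e o mult.commute mult.left_commute)
  then show ?thesis by (simp add: s distrib_right)
qed

section \<open>The random walk stopped at an independent time\<close>

definition walk_steps :: "(nat \<Rightarrow> 'a \<Rightarrow> int) \<Rightarrow> ('a \<Rightarrow> nat) \<Rightarrow> 'a \<Rightarrow> int list" where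
  "walk_steps S N \<omega> = map (\<lambda>i. S (Suc i) \<omega> - S i \<omega>) [0..<N \<omega>]"

lemma walk_range_centres:
  assumes "S 0 \<omega> = 0"
  shows "walk_range S (N \<omega>) \<omega> = centres 0 (walk_steps S N \<omega>)"
proof -
  have "centres (S i \<omega>) (map (\<lambda>i. S (Suc i) \<omega> - S i \<omega>) [i..<i + k]) = (\<lambda>j. S j \<omega>) ` {i..i + k}" for i k
  proof (induction k arbitrary: i)
    case (Suc k)
    have "[i..<i + Suc k] = i # [Suc i..<Suc i + k]" by (subst upt_rec) simp
    then have "centres (S i \<omega>) (map (\<lambda>i. S (Suc i) \<omega> - S i \<omega>) [i..<i + Suc k]) =
        insert (S i \<omega>) ((\<lambda>j. S j \<omega>) ` {Suc i..Suc i + k})"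
      using Suc[of "Suc i"] by simp
    also have "\<dots> = (\<lambda>j. S j \<omega>) ` insert i {Suc i..Suc i + k}" by simp
    also have "insert i {Suc i..Suc i + k} = {i..i + Suc k}" by auto
    finally show ?case .
  qed simp
  from this[of 0 "N \<omega>"] show ?thesis
    using assms by (auto simp: walk_steps_def walk_range_def)
qed

text \<open>The event says that \<open>N\<close> is the length of \<open>es\<close> and that the
  first increments follow \<open>es\<close>. Independence of \<open>N\<close> and the path splits
  off \<open>pmf p\<close>, and independence of the increments gives one half per entry.\<close>

lemma (in prob_space) prob_walk_steps:
  assumes "simple_random_walk M S" "independent_time M S N p"
  shows "{\<omega> \<in> space M. walk_steps S N \<omega> = es} \<in> events"
    and "prob {\<omega> \<in> space M. walk_steps S N \<omega> = es} =
      pmf p (length es) * (if set es \<subseteq> {-1, 1} then (1 / 2) ^ length es else 0)"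
proof -
  let ?X = "\<lambda>i \<omega>. S (Suc i) \<omega> - S i \<omega>"
  let ?r = "length es"
  have iv: "indep_vars (\<lambda>_. count_space UNIV) ?X UNIV"
    and dX: "\<And>i. distr M (count_space UNIV) (?X i) = measure_pmf (pmf_of_set {-1, 1})"
    using assms(1) unfolding simple_random_walk_def by auto
  have N: "N \<in> measurable M (count_space UNIV)" and dN: "distr M (count_space UNIV) N = measure_pmf p"
    and ind: "indep_set
       {N -` A \<inter> space M | A. A \<in> sets (count_space UNIV)}
       {(\<lambda>\<omega> i. S i \<omega>) -` B \<inter> space M | B. B \<in> sets (\<Pi>\<^sub>M i\<in>UNIV. count_space UNIV)}"
    using assms(2) unfolding independent_time_def by auto
  have X: "?X i \<in> measurable M (count_space UNIV)" for i
    using iv unfolding indep_vars_def by auto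
  \<comment> \<open>A set of paths rather than of increments, since the independence of
    \<open>N\<close> is stated for the path.\<close>
  define B :: "(nat \<Rightarrow> int) set" where "B = {x. \<forall>i<?r. x (Suc i) - x i = es ! i}"
  have "B \<in> sets (\<Pi>\<^sub>M i\<in>UNIV. count_space UNIV)"
  proof -
    have comp: "(\<lambda>x. x i) \<in> measurable (\<Pi>\<^sub>M i\<in>(UNIV::nat set). count_space (UNIV :: int set)) (count_space UNIV)" for i
      by (rule measurable_component_singleton) simp
    have "(\<lambda>x. x (Suc i) - x i) \<in> measurable (\<Pi>\<^sub>M i\<in>(UNIV::nat set). count_space (UNIV :: int set)) (count_space UNIV)" for i
      by (rule measurable_compose_countable[OF measurable_compose[OF comp] comp]) simp
    from measurable_sets[OF this, of "{es ! i}" i for i]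
    have "{x \<in> space (\<Pi>\<^sub>M i\<in>(UNIV::nat set). count_space (UNIV :: int set)). x (Suc i) - x i = es ! i}
        \<in> sets (\<Pi>\<^sub>M i\<in>UNIV. count_space UNIV)" for i
      by (simp add: vimage_def Int_def conj_commute)
    then have "{x \<in> space (\<Pi>\<^sub>M i\<in>(UNIV::nat set). count_space (UNIV :: int set)).
        \<forall>i\<in>{..<?r}. x (Suc i) - x i = es ! i} \<in> sets (\<Pi>\<^sub>M i\<in>UNIV. count_space UNIV)"
      by (intro sets.sets_Collect_finite_All) auto
    moreover have "space (\<Pi>\<^sub>M i\<in>(UNIV::nat set). count_space (UNIV :: int set)) = UNIV"
      by (auto simp: space_PiM)
    ultimately show ?thesis by (simp add: B_def lessThan_iff Ball_def)
  qed
  then have b: "(\<lambda>\<omega> i. S i \<omega>) -` B \<inter> space M \<in>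
      {(\<lambda>\<omega> i. S i \<omega>) -` B \<inter> space M | B. B \<in> sets (\<Pi>\<^sub>M i\<in>UNIV. count_space UNIV)}"
    by blast
  have a: "N -` {?r} \<inter> space M \<in> {N -` A \<inter> space M | A. A \<in> sets (count_space UNIV)}"
    by auto
  have eq: "{\<omega> \<in> space M. walk_steps S N \<omega> = es} =
      (N -` {?r} \<inter> space M) \<inter> ((\<lambda>\<omega> i. S i \<omega>) -` B \<inter> space M)"
    by (auto simp: walk_steps_def B_def list_eq_iff_nth_eq)
  show "{\<omega> \<in> space M. walk_steps S N \<omega> = es} \<in> events"
    unfolding eq using a b indep_setD_ev1[OF ind] indep_setD_ev2[OF ind] by (meson sets.Int subsetD)
  have pN: "prob (N -` {?r} \<inter> space M) = pmf p ?r"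
    using measure_distr[OF N, of "{?r}"] by (simp add: dN measure_pmf_single)
  have pX: "prob (?X i -` {e} \<inter> space M) = (if e \<in> {-1, 1} then 1 / 2 else 0)" for i e
    using measure_distr[OF X, of "{e}" i] by (auto simp: dX measure_pmf_single pmf_of_set)
  have "prob ((\<lambda>\<omega> i. S i \<omega>) -` B \<inter> space M) = (\<Prod>i<?r. if es ! i \<in> {-1, 1} then 1 / 2 else 0)"
  \<comment> \<open>The empty list is separate: an empty intersection would be the whole type
    instead of \<open>space M\<close>.\<close>
  proof (cases "?r = 0")
    case True
    then show ?thesis using prob_space by (simp add: B_def)
  next
    case False
    then have "(\<lambda>\<omega> i. S i \<omega>) -` B \<inter> space M = (\<Inter>i\<in>{..<?r}. ?X i -` {es ! i} \<inter> space M)"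
      by (auto simp: B_def)
    then have "prob ((\<lambda>\<omega> i. S i \<omega>) -` B \<inter> space M) = (\<Prod>i<?r. prob (?X i -` {es ! i} \<inter> space M))"
      using False by (simp only:) (intro indep_varsD[OF iv]; auto)
    then show ?thesis by (simp only: pX)
  qed
  also have "\<dots> = (if set es \<subseteq> {-1, 1} then (1 / 2) ^ ?r else 0)"
  proof (cases "set es \<subseteq> {-1, 1}")
    case True
    then have "es ! i \<in> {-1, 1}" if "i < ?r" for i using that nth_mem by blast
    then have "(\<Prod>i<?r. if es ! i \<in> {-1, 1} then 1 / 2 else 0 :: real) = (\<Prod>i<?r. 1 / 2)"
      by (intro prod.cong) auto
    then show ?thesis using True by simp
  next
    case False
    then obtain i where "i < ?r" "es ! i \<notin> {-1, 1}" by (metis in_set_conv_nth subsetI)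
    then show ?thesis using False by (auto intro!: prod_zero)
  qed
  finally show "prob {\<omega> \<in> space M. walk_steps S N \<omega> = es} =
      pmf p ?r * (if set es \<subseteq> {-1, 1} then (1 / 2) ^ ?r else 0)"
    unfolding eq using indep_setD[OF ind a b] pN by simp
qed

text \<open>\<open>A\<close> is exhausted by the finite sets of elements with bounded
  \<open>to_nat\<close>; then continuity from below applies.\<close>

lemma (in prob_space) finite_fibres_approx:
  fixes Y :: "'a \<Rightarrow> 'c :: countable"
  assumes "\<And>y. {\<omega> \<in> space M. Y \<omega> = y} \<in> events" "0 < \<eta>"
  obtains E where "finite E" "E \<subseteq> A"
    "prob {\<omega> \<in> space M. Y \<omega> \<in> A} - \<eta> < (\<Sum>y\<in>E. prob {\<omega> \<in> space M. Y \<omega> = y})"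
proof -
  define E where "E k = {y \<in> A. to_nat y \<le> k}" for k
  have fin: "finite (E k)" for k
    by (rule finite_subset[OF _ finite_imageD[of to_nat "{y. to_nat y \<le> k}"]])
       (auto simp: E_def inj_on_def intro: finite_subset[of _ "{..k}"])
  have ev: "{\<omega> \<in> space M. Y \<omega> \<in> E k} \<in> events" for k
  proof -
    have "{\<omega> \<in> space M. Y \<omega> \<in> E k} = (\<Union>y\<in>E k. {\<omega> \<in> space M. Y \<omega> = y})" by auto
    then show ?thesis using assms(1) fin by (auto intro!: sets.finite_UN)
  qed
  have un: "(\<Union>k. {\<omega> \<in> space M. Y \<omega> \<in> E k}) = {\<omega> \<in> space M. Y \<omega> \<in> A}"
    by (auto simp: E_def)
  have "(\<lambda>k. prob {\<omega> \<in> space M. Y \<omega> \<in> E k}) \<longlonglongrightarrow> prob {\<omega> \<in> space M. Y \<omega> \<in> A}"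
    unfolding un[symmetric] using ev by (intro finite_Lim_measure_incseq) (auto simp: incseq_def E_def)
  then have "\<forall>\<^sub>F k in sequentially. prob {\<omega> \<in> space M. Y \<omega> \<in> A} - \<eta> < prob {\<omega> \<in> space M. Y \<omega> \<in> E k}"
    using assms(2) by (intro order_tendstoD) auto
  then obtain k where k: "prob {\<omega> \<in> space M. Y \<omega> \<in> A} - \<eta> < prob {\<omega> \<in> space M. Y \<omega> \<in> E k}"
    by (auto simp: eventually_sequentially)
  have "{\<omega> \<in> space M. Y \<omega> \<in> E k} = (\<Union>y\<in>E k. {\<omega> \<in> space M. Y \<omega> = y})" by auto
  then have "prob {\<omega> \<in> space M. Y \<omega> \<in> E k} = (\<Sum>y\<in>E k. prob {\<omega> \<in> space M. Y \<omega> = y})"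
    using fin assms(1)
    by (simp only:) (intro finite_measure_finite_Union; auto simp: disjoint_family_on_def)
  then show ?thesis using that[of "E k"] fin k by (auto simp: E_def)
qed

text \<open>For probabilities, lower bounds for an event and for its complement pin down the
  limit.\<close>

lemma tendsto_from_lower_bounds:
  fixes a :: "nat \<Rightarrow> real"
  assumes "\<And>\<eta>. 0 < \<eta> \<Longrightarrow> \<forall>\<^sub>F j in sequentially. t - \<eta> \<le> a j"
    and "\<And>\<eta>. 0 < \<eta> \<Longrightarrow> \<forall>\<^sub>F j in sequentially. (1 - t) - \<eta> \<le> 1 - a j"
  shows "a \<longlonglongrightarrow> t"
proof (rule tendstoI)
  fix e :: real assume "0 < e"
  then have e: "0 < e / 2" by simp
  show "\<forall>\<^sub>F j in sequentially. dist (a j) t < e"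
    using assms(1)[OF e] assms(2)[OF e]
    by eventually_elim (use \<open>0 < e\<close> in \<open>auto simp: dist_real_def abs_le_iff\<close>)
qed

section \<open>Asymptotics\<close>

text \<open>This is \<open>(1 / 2) ^ r\<close> times the mass at \<open>r\<close> of the
  parity-biased Poisson law with bias \<open>par b / par (Suc b)\<close>. The parity of the
  \<open>n j\<close> is carried by \<open>b\<close>.\<close>

definition pattern_weight :: "real \<Rightarrow> nat \<Rightarrow> nat \<Rightarrow> real" where
  "pattern_weight \<kappa> b r =
     (\<kappa> / 2) ^ r / fact r * par (b + r) / (par b * cosh \<kappa> + par (Suc b) * sinh \<kappa>)"

lemma par_cong: "even m \<longleftrightarrow> even k \<Longrightarrow> par m = par k"
  by (simp add: par_def)

lemma par_pos: "0 < par m"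
  by (simp add: par_def)

text \<open>
  The free parameter \<open>N\<close> of the lower bound is taken of order \<open>n / 2\<close>, but at distance at least
  \<open>d\<close> below its maximal value, so that both error terms vanish.
\<close>

lemma Hom0_pattern_ratio_tendsto:
  fixes lam :: real and n d :: "nat \<Rightarrow> nat"
  assumes "0 < lam" "filterlim n at_top sequentially"
    and lim: "(\<lambda>j. real (n j) * 2 powr (- real (d j))) \<longlonglongrightarrow> lam"
    and parity: "\<forall>\<^sub>F j in sequentially. even (n j) \<longleftrightarrow> even b"
    and es: "set es \<subseteq> {-1, 1}"
  obtains L where "L \<longlonglongrightarrow> pattern_weight (lam / (2 * sqrt 2)) b (length es)"
    and "\<forall>\<^sub>F j in sequentially. L j \<le>
      real (cnt0 (d j) 0 1 ((=) (Some es)) (n j - 1) + cnt0 (d j) 0 (-1) ((=) (Some es)) (n j - 1))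
        / real (card (Hom0 (n j) (d j)))"
proof -
  define r where "r = length es"
  define x where "x j = (1 / 2 :: real) ^ d j" for j
  define D where "D j = r * (2 * d j + 3)" for j
  define N where "N j = (n j - D j) div 2 - d j" for j
  define X where "X j = real (n j) / (2 * sqrt 2 * 2 ^ d j)" for j
  define Z where "Z j = par b * cosh (X j) + par (Suc b) * sinh (X j)" for j
  define \<kappa> where "\<kappa> = lam / (2 * sqrt 2)"
  \<comment> \<open>The quotient of the bounds in \<open>cnt0_pattern_lower\<close> and
    \<open>cnt0_total_upper\<close>, both divided by \<open>sqrt 2 ^ n j / 4\<close>. The term
    \<open>16 * x j\<close> replaces the error \<open>2 ^ (N j + 2)\<close>, and the factor 2 from
    the sign of \<open>f 1\<close> cancels.\<close>
  define L where "L j = (real (N j) * x j / (2 * sqrt 2)) ^ r / fact r * (par (b + r) - 16 * x j)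
      / (4 * (1 / sqrt 2) ^ n j + Z j)" for j
  have nx: "(\<lambda>j. real (n j) * x j) \<longlonglongrightarrow> lam"
  proof -
    have "2 powr (- real (d j)) = x j" for j
      by (simp add: x_def powr_minus powr_realpow power_one_over inverse_eq_divide)
    then show ?thesis using lim by simp
  qed
  have n_inf: "filterlim (\<lambda>j. real (n j)) at_top sequentially"
    by (rule filterlim_compose[OF filterlim_real_sequentially assms(2)])
  \<comment> \<open>As \<open>n\<close> tends to infinity while \<open>n j * x j\<close> converges,
    \<open>x\<close> vanishes, and therefore \<open>d\<close> tends to infinity.\<close>
  have x0: "x \<longlonglongrightarrow> 0"
  proof -
    have "(\<lambda>j. real (n j) * x j * inverse (real (n j))) \<longlonglongrightarrow> lam * 0"
      by (intro tendsto_mult nx filterlim_compose[OF tendsto_inverse_0_at_top n_inf])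
         (rule filterlim_ident)
    moreover have "\<forall>\<^sub>F j in sequentially. real (n j) * x j * inverse (real (n j)) = x j"
      using filterlim_at_top_dense[THEN iffD1, OF n_inf, rule_format, of 0]
      by eventually_elim simp
    ultimately show ?thesis by (simp add: tendsto_cong)
  qed
  have d_inf: "filterlim d at_top sequentially"
    unfolding filterlim_at_top
  proof
    fix K
    have "\<forall>\<^sub>F j in sequentially. x j < (1 / 2) ^ K"
      using x0 by (intro order_tendstoD) auto
    then show "\<forall>\<^sub>F j in sequentially. K \<le> d j"
    proof eventually_elim
      case (elim j)
      show ?case
      proof (rule ccontr)
        assume "\<not> K \<le> d j"
        then have "(1 / 2 :: real) ^ K \<le> (1 / 2) ^ d j" by (intro power_decreasing) auto
        then show False using elim by (simp add: x_def)
      qed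
    qed
  qed
  have dx: "(\<lambda>j. real (d j) * x j) \<longlonglongrightarrow> 0"
  proof -
    have "(\<lambda>k. real k * (1 / 2) ^ k) \<longlonglongrightarrow> 0"
      using powser_times_n_limit_0[of "1 / 2 :: real"] by simp
    from filterlim_compose[OF this d_inf] show ?thesis by (simp add: x_def)
  qed
  \<comment> \<open>\<open>D\<close> is linear in \<open>d\<close>, hence negligible against
    \<open>2 ^ d\<close>, which has the order of \<open>n\<close>. So \<open>N\<close> is
    asymptotically \<open>n / 2\<close>.\<close>
  have Dx: "(\<lambda>j. (real (D j) + 2 * real (d j) + 5) * x j) \<longlonglongrightarrow> 0"
  proof -
    have "(\<lambda>j. (2 * real r + 2) * (real (d j) * x j) + (3 * real r + 5) * x j)
        \<longlonglongrightarrow> (2 * real r + 2) * 0 + (3 * real r + 5) * 0"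
      by (intro tendsto_intros dx x0)
    then show ?thesis by (simp add: D_def algebra_simps)
  qed
  have big: "\<forall>\<^sub>F j in sequentially. D j + 2 * d j + 5 \<le> n j"
  proof -
    have "\<forall>\<^sub>F j in sequentially. lam / 2 < real (n j) * x j"
      "\<forall>\<^sub>F j in sequentially. (real (D j) + 2 * real (d j) + 5) * x j < lam / 2"
      by (rule order_tendstoD(1)[OF nx] order_tendstoD(2)[OF Dx]; use assms(1) in simp)+
    then show ?thesis
    proof eventually_elim
      case (elim j)
      then have "(real (D j) + 2 * real (d j) + 5) * x j \<le> real (n j) * x j" by linarith
      moreover have "0 < x j" by (simp add: x_def)
      ultimately have "real (D j) + 2 * real (d j) + 5 \<le> real (n j)" by simp
      then have "real (D j + 2 * d j + 5) \<le> real (n j)" by simp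
      then show ?case by (simp only: of_nat_le_iff)
    qed
  qed
  have Nx: "(\<lambda>j. real (N j) * x j) \<longlonglongrightarrow> lam / 2"
  proof (rule tendsto_sandwich)
    have "(\<lambda>j. real (n j) * x j / 2 - (real (D j) + 2 * real (d j) + 5) * x j) \<longlonglongrightarrow> lam / 2 - 0"
      by (intro tendsto_diff Dx tendsto_divide nx tendsto_const) simp
    then show "(\<lambda>j. real (n j) * x j / 2 - (real (D j) + 2 * real (d j) + 5) * x j) \<longlonglongrightarrow> lam / 2"
      by simp
    show "(\<lambda>j. real (n j) * x j / 2) \<longlonglongrightarrow> lam / 2"
      by (intro tendsto_divide nx tendsto_const) simp
    show "\<forall>\<^sub>F j in sequentially. real (n j) * x j / 2 - (real (D j) + 2 * real (d j) + 5) * x j \<le> real (N j) * x j"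
      using big
    proof eventually_elim
      case (elim j)
      have "n j \<le> 2 * N j + D j + 2 * d j + 1"
        unfolding N_def using elim by linarith
      then have "real (n j) / 2 - (real (D j) + 2 * real (d j) + 5) \<le> real (N j)" by linarith
      then have "(real (n j) / 2 - (real (D j) + 2 * real (d j) + 5)) * x j \<le> real (N j) * x j"
        by (intro mult_right_mono) (simp_all add: x_def)
      then show ?case by (simp add: algebra_simps)
    qed
    show "\<forall>\<^sub>F j in sequentially. real (N j) * x j \<le> real (n j) * x j / 2"
    proof (intro always_eventually allI)
      fix j
      have "2 * N j \<le> n j" unfolding N_def by linarith
      then have "real (N j) \<le> real (n j) / 2" by linarith
      then have "real (N j) * x j \<le> real (n j) / 2 * x j"
        by (intro mult_right_mono) (simp_all add: x_def)
      then show "real (N j) * x j \<le> real (n j) * x j / 2" by simp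
    qed
  qed
  have X: "X \<longlonglongrightarrow> \<kappa>"
  proof -
    have "(\<lambda>j. real (n j) * x j / (2 * sqrt 2)) \<longlonglongrightarrow> lam / (2 * sqrt 2)"
      by (intro tendsto_divide nx tendsto_const) simp
    moreover have "real (n j) * x j / (2 * sqrt 2) = X j" for j
      by (simp add: X_def x_def power_divide)
    ultimately show ?thesis by (simp add: \<kappa>_def)
  qed
  have "0 < \<kappa>" using assms(1) by (simp add: \<kappa>_def)
  have Zpos: "0 < par b * cosh \<kappa> + par (Suc b) * sinh \<kappa>"
    using \<open>0 < \<kappa>\<close> par_pos by (intro add_pos_pos mult_pos_pos) (auto simp: cosh_real_pos)
  have inv0: "(\<lambda>j. (1 / sqrt 2) ^ n j) \<longlonglongrightarrow> 0"
    by (rule filterlim_compose[OF LIMSEQ_power_zero assms(2)]) simp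
  have "L \<longlonglongrightarrow> (lam / 2 / (2 * sqrt 2)) ^ r / fact r * (par (b + r) - 16 * 0)
      / (4 * 0 + (par b * cosh \<kappa> + par (Suc b) * sinh \<kappa>))"
    unfolding L_def Z_def
    by (intro tendsto_intros Nx x0 inv0 tendsto_cosh tendsto_sinh X) (use Zpos in simp_all)
  then have "L \<longlonglongrightarrow> pattern_weight (lam / (2 * sqrt 2)) b (length es)"
    by (simp add: pattern_weight_def \<kappa>_def r_def mult.commute)
  moreover have "\<forall>\<^sub>F j in sequentially. L j \<le>
      real (cnt0 (d j) 0 1 ((=) (Some es)) (n j - 1) + cnt0 (d j) 0 (-1) ((=) (Some es)) (n j - 1))
        / real (card (Hom0 (n j) (d j)))"
    using big parity filterlim_at_top[THEN iffD1, OF d_inf, rule_format, of 2]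
  proof eventually_elim
    case (elim j)
    have d: "0 < d j" "1 \<le> d j" and n: "1 \<le> n j" using elim by auto
    have N1: "D j + 2 * N j + 2 * d j \<le> n j" unfolding N_def using elim(1) by linarith
    define c where "c = sqrt 2 ^ n j / (4::real)"
    have c: "0 < c" by (simp add: c_def)
    have p: "par (n j + r) = par (b + r)" "par (n j) = par b" "par (Suc (n j)) = par (Suc b)"
      using elim(2) by (auto intro!: par_cong)
    have Zj: "0 \<le> Z j"
      unfolding Z_def X_def using par_pos
      by (intro add_nonneg_nonneg mult_nonneg_nonneg) (auto simp: less_imp_le cosh_real_nonneg)
    have up: "real (card (Hom0 (n j) (d j))) \<le> 2 * (1 + c * Z j)"
      using cnt0_total_upper[OF d(1) n, of 1] cnt0_total_upper[OF d(1) n, of "-1"]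
      by (simp add: card_Hom0[OF n d(2)] c_def Z_def X_def p)
    have pos: "0 < real (card (Hom0 (n j) (d j)))"
      using Hom0_nonempty Hom0_finite by (simp add: card_gt_0_iff)
    define A where "A = (real (N j) * x j / (2 * sqrt 2)) ^ r / fact r"
    have A: "0 \<le> A" by (simp add: A_def x_def)
    have sD: "sqrt 2 ^ D j = (2 ^ d j * (2 * sqrt 2)) ^ r"
    proof -
      have "sqrt 2 ^ (2 * d j + 3) = 2 ^ d j * (2 * sqrt (2::real))"
        by (simp add: power_add power_mult power3_eq_cube)
      then show ?thesis by (simp add: D_def power_mult mult.commute[of r])
    qed
    have "c * (A * (par (b + r) - 16 * x j)) \<le> real (N j) ^ r / fact r *
        (sqrt 2 ^ (n j - D j) * par (n j + r) / 4 - 2 ^ (N j + 2))"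
    proof -
      have split: "sqrt 2 ^ n j = sqrt 2 ^ (n j - D j) * sqrt (2::real) ^ D j"
        using elim(1) by (simp flip: power_add)
      have A': "A * sqrt 2 ^ D j = real (N j) ^ r / fact r"
        unfolding A_def sD by (simp add: x_def power_divide power_mult_distrib field_simps)
      have "2 ^ (N j + d j) = sqrt (2::real) ^ (2 * (N j + d j))" by (subst power_mult) simp
      also have "\<dots> \<le> sqrt 2 ^ (n j - D j)" using N1 by (intro power_increasing) auto
      finally have "2 ^ (N j + d j) * x j \<le> sqrt 2 ^ (n j - D j) * x j"
        by (intro mult_right_mono) (simp_all add: x_def)
      \<comment> \<open>The distance \<open>d\<close> kept from the maximal \<open>N\<close>, that
        is \<open>2 * (N j + d j) \<le> n j - D j\<close>, yields the vanishing factor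
        \<open>x j\<close>.\<close>
      then have err: "2 ^ (N j + 2) \<le> sqrt 2 ^ (n j - D j) / 4 * (16 * x j)"
        by (simp add: x_def power_add power_divide)
      have "c * (A * (par (b + r) - 16 * x j)) =
          A * sqrt 2 ^ D j * (sqrt 2 ^ (n j - D j) * par (b + r) / 4 - sqrt 2 ^ (n j - D j) / 4 * (16 * x j))"
        unfolding c_def split by (simp add: field_simps)
      also have "\<dots> \<le> A * sqrt 2 ^ D j * (sqrt 2 ^ (n j - D j) * par (b + r) / 4 - 2 ^ (N j + 2))"
        using A err by (intro mult_left_mono diff_left_mono) auto
      finally show ?thesis unfolding A' p .
    qed
    also have "\<dots> \<le> real (cnt0 (d j) 0 s ((=) (Some es)) (n j - 1))" if "\<bar>s\<bar> = 1" for s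
      using cnt0_pattern_lower[OF d(1) es that, of "N j" "n j"] N1 elim(3)
      by (simp add: D_def r_def)
    finally have low: "c * (A * (par (b + r) - 16 * x j)) \<le> real (cnt0 (d j) 0 s ((=) (Some es)) (n j - 1))"
      if "\<bar>s\<bar> = 1" for s using that .
    have c4: "4 * (1 / sqrt 2) ^ n j = 1 / c" by (simp add: c_def power_divide)
    let ?W = "real (cnt0 (d j) 0 1 ((=) (Some es)) (n j - 1) + cnt0 (d j) 0 (-1) ((=) (Some es)) (n j - 1))"
    have "L j = 2 * (c * (A * (par (b + r) - 16 * x j))) / (2 * (1 + c * Z j))"
    proof -
      have "L j = A * (par (b + r) - 16 * x j) / (1 / c + Z j)"
        by (simp add: L_def A_def c4)
      also have "1 / c + Z j = (1 + c * Z j) / c" using c by (simp add: field_simps)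
      finally have "L j = c * (A * (par (b + r) - 16 * x j)) / (1 + c * Z j)"
        by (simp add: mult.commute mult.left_commute)
      then show ?thesis by (subst mult_divide_mult_cancel_left) simp_all
    qed
    also have "\<dots> \<le> ?W / (2 * (1 + c * Z j))"
      using low[of 1] low[of "-1"] c Zj by (intro divide_right_mono) auto
    also have "\<dots> \<le> ?W / real (card (Hom0 (n j) (d j)))"
      using up pos by (intro divide_left_mono) auto
    finally show ?case .
  qed
  ultimately show ?thesis using that by blast
qed

section \<open>From single lists to the law of the range\<close>

lemma Hom0_range_prob_lower:
  fixes lam :: real and n d :: "nat \<Rightarrow> nat"
  assumes "0 < lam" "filterlim n at_top sequentially"
    and "(\<lambda>j. real (n j) * 2 powr (- real (d j))) \<longlonglongrightarrow> lam"
    and "\<forall>\<^sub>F j in sequentially. even (n j) \<longleftrightarrow> even b"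
    and "\<forall>\<^sub>F j in sequentially. 1 \<le> n j \<and> 1 \<le> d j"
    and E: "finite E" "\<And>es. es \<in> E \<Longrightarrow> set es \<subseteq> {-1, 1}"
      "\<And>es. es \<in> E \<Longrightarrow> R (card (centres 0 es) + 2)"
    and "t < (\<Sum>es\<in>E. pattern_weight (lam / (2 * sqrt 2)) b (length es))"
  shows "\<forall>\<^sub>F j in sequentially.
    t \<le> measure (measure_pmf (pmf_of_set (Hom0 (n j) (d j)))) {f. R (card (f ` {0..n j}))}"
proof -
  let ?W = "\<lambda>es j. real (cnt0 (d j) 0 1 ((=) (Some es)) (n j - 1) + cnt0 (d j) 0 (-1) ((=) (Some es)) (n j - 1))
        / real (card (Hom0 (n j) (d j)))"
  have "\<forall>es\<in>E. \<exists>L. L \<longlonglongrightarrow> pattern_weight (lam / (2 * sqrt 2)) b (length es) \<and>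
      (\<forall>\<^sub>F j in sequentially. L j \<le> ?W es j)"
    by (intro ballI, rule Hom0_pattern_ratio_tendsto[OF assms(1-4) E(2)]) blast+
  from bchoice[OF this] obtain L where L: "\<And>es. es \<in> E \<Longrightarrow> L es \<longlonglongrightarrow> pattern_weight (lam / (2 * sqrt 2)) b (length es)"
    and le: "\<And>es. es \<in> E \<Longrightarrow> \<forall>\<^sub>F j in sequentially. L es j \<le> ?W es j"
    by blast
  have "(\<lambda>j. \<Sum>es\<in>E. L es j) \<longlonglongrightarrow> (\<Sum>es\<in>E. pattern_weight (lam / (2 * sqrt 2)) b (length es))"
    by (intro tendsto_sum L)
  then have "\<forall>\<^sub>F j in sequentially. t < (\<Sum>es\<in>E. L es j)"
    using assms(9) by (rule order_tendstoD)
  moreover have "\<forall>\<^sub>F j in sequentially. \<forall>es\<in>E. L es j \<le> ?W es j"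
    using E(1) le by (intro eventually_ball_finite) auto
  ultimately show ?thesis
    using assms(5)
  proof eventually_elim
    case (elim j)
    have "t \<le> (\<Sum>es\<in>E. ?W es j)"
      using elim(1) sum_mono[of E "\<lambda>es. L es j" "\<lambda>es. ?W es j"] elim(2) by fastforce
    also have "\<dots> = real (\<Sum>es\<in>E. cnt0 (d j) 0 1 ((=) (Some es)) (n j - 1) + cnt0 (d j) 0 (-1) ((=) (Some es)) (n j - 1))
        / real (card (Hom0 (n j) (d j)))"
      by (simp only: of_nat_sum sum_divide_distrib)
    also have "\<dots> \<le> real (card {f \<in> Hom0 (n j) (d j). R (card (f ` {0..n j}))}) / real (card (Hom0 (n j) (d j)))"
      using card_Hom0_range_ge[of "n j" "d j" E R] E elim(3)
      by (intro divide_right_mono) (auto simp only: of_nat_le_iff of_nat_0_le_iff)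
    also have "\<dots> = measure (measure_pmf (pmf_of_set (Hom0 (n j) (d j)))) {f. R (card (f ` {0..n j}))}"
      using Hom0_nonempty Hom0_finite by (simp add: measure_pmf_of_set Int_def)
    finally show ?case .
  qed
qed

text \<open>Finitely many lists capture almost all of the limit law, which gives the lower bound for
  every predicate \<open>R\<close> on range sizes. Using it for \<open>R\<close> and for its
  negation yields convergence of the probabilities, in particular of the distribution functions at
  every point.\<close>

lemma range_weak_conv:
  fixes lam :: real and n d :: "nat \<Rightarrow> nat"
    and M :: "'a measure" and S :: "nat \<Rightarrow> 'a \<Rightarrow> int" and N :: "'a \<Rightarrow> nat"
  assumes "0 < lam" "filterlim n at_top sequentially"
    and "(\<lambda>j. real (n j) * 2 powr (- real (d j))) \<longlonglongrightarrow> lam"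
    and "\<forall>\<^sub>F j in sequentially. even (n j) \<longleftrightarrow> even b"
    and "\<forall>\<^sub>F j in sequentially. 1 \<le> n j \<and> 1 \<le> d j"
    and srw: "simple_random_walk M S"
    and ind: "independent_time M S N (parity_biased_poisson (lam / (2 * sqrt 2)) (par b / par (Suc b)))"
  shows "weak_conv_m (\<lambda>j. hom_range_size_distr (n j) (d j))
    (distr M borel (\<lambda>\<omega>. real (card (walk_range S (N \<omega>) \<omega>) + 2)))"
proof -
  interpret prob_space M using srw by (simp add: simple_random_walk_def)
  define \<kappa> where "\<kappa> = lam / (2 * sqrt 2)"
  have "0 < \<kappa>" using assms(1) by (simp add: \<kappa>_def)
  let ?Y = "walk_steps S N"
  define q where "q R = prob {\<omega> \<in> space M. ?Y \<omega> \<in> {es. R (card (centres 0 es) + 2)}}" for R :: "nat \<Rightarrow> bool"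
  define m where "m j R = measure (measure_pmf (pmf_of_set (Hom0 (n j) (d j)))) {f. R (card (f ` {0..n j}))}"
    for j and R :: "nat \<Rightarrow> bool"
  note fibre = prob_walk_steps[OF srw ind]
  have "?Y -` {es} \<inter> space M \<in> events" for es
    using fibre(1)[of es] by (simp add: vimage_def Int_def conj_commute)
  then have Ymeas: "?Y \<in> measurable M (count_space UNIV)"
    by (simp add: measurable_count_space_eq2_countable)
  have pw: "pmf (parity_biased_poisson (lam / (2 * sqrt 2)) (par b / par (Suc b))) r * (1 / 2) ^ r =
      pattern_weight \<kappa> b r" for r
  proof -
    have p: "0 < par b" "0 < par (Suc b)" by (rule par_pos)+
    have "par b / par (Suc b) * cosh \<kappa> + sinh \<kappa> = (par b * cosh \<kappa> + par (Suc b) * sinh \<kappa>) / par (Suc b)"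
      using p by (simp add: field_simps)
    moreover have "(if even r then par b / par (Suc b) else 1) = par (b + r) / par (Suc b)"
      using p by (auto intro!: par_cong)
    ultimately show ?thesis
      using \<open>0 < \<kappa>\<close> p
      by (simp add: pmf_parity_biased_poisson pattern_weight_def power_divide mult_ac flip: \<kappa>_def)
  qed
  have lower: "\<forall>\<^sub>F j in sequentially. q R - \<eta> \<le> m j R" if eta: "0 < \<eta>" for R \<eta>
  proof -
    obtain E where E: "finite E" "E \<subseteq> {es. R (card (centres 0 es) + 2)}"
      "q R - \<eta> < (\<Sum>es\<in>E. prob {\<omega> \<in> space M. ?Y \<omega> = es})"
      unfolding q_def by (rule finite_fibres_approx[OF fibre(1) eta])
    \<comment> \<open>Lists with entries other than \<plusminus>1 have probability 0, while the
      counting bounds concern unit steps.\<close>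
    define F where "F = {es \<in> E. set es \<subseteq> {-1, 1}}"
    have "(\<Sum>es\<in>E. prob {\<omega> \<in> space M. ?Y \<omega> = es}) = (\<Sum>es\<in>F. prob {\<omega> \<in> space M. ?Y \<omega> = es})"
      using E(1) by (intro sum.mono_neutral_right) (auto simp: F_def fibre(2))
    also have "\<dots> = (\<Sum>es\<in>F. pattern_weight \<kappa> b (length es))"
      by (intro sum.cong) (auto simp: F_def fibre(2) pw)
    finally have "q R - \<eta> < (\<Sum>es\<in>F. pattern_weight (lam / (2 * sqrt 2)) b (length es))"
      using E(3) by (simp add: \<kappa>_def)
    then show ?thesis
      unfolding m_def using E
      by (intro Hom0_range_prob_lower[OF assms(1-5), of F]) (auto simp: F_def)
  qed
  have lim: "(\<lambda>j. m j R) \<longlonglongrightarrow> q R" for R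
  proof (rule tendsto_from_lower_bounds[OF lower])
    fix \<eta> :: real assume "0 < \<eta>"
    define A where "A = {es. R (card (centres 0 es) + 2)}"
    have ev: "{\<omega> \<in> space M. ?Y \<omega> \<in> A} \<in> events"
      using measurable_sets[OF Ymeas, of A] by (simp add: vimage_def Int_def conj_commute)
    have "{\<omega> \<in> space M. ?Y \<omega> \<in> - A} = space M - {\<omega> \<in> space M. ?Y \<omega> \<in> A}" by auto
    moreover have "- A = {es. \<not> R (card (centres 0 es) + 2)}" by (auto simp: A_def)
    ultimately have "q (\<lambda>k. \<not> R k) = 1 - q R"
      using prob_compl[OF ev] by (simp add: q_def A_def)
    moreover have "m j (\<lambda>k. \<not> R k) = 1 - m j R" for j
    proof -
      let ?p = "measure_pmf (pmf_of_set (Hom0 (n j) (d j)))"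
      have "{f. \<not> R (card (f ` {0..n j}))} = space ?p - {f. R (card (f ` {0..n j}))}" by auto
      then show ?thesis
        unfolding m_def by (simp only:) (rule measure_pmf.prob_compl, simp)
    qed
    ultimately show "\<forall>\<^sub>F j in sequentially. 1 - q R - \<eta> \<le> 1 - m j R"
      using lower[OF \<open>0 < \<eta>\<close>, of "\<lambda>k. \<not> R k"] by simp
  qed
  have wr: "card (walk_range S (N \<omega>) \<omega>) = card (centres 0 (?Y \<omega>))" if "\<omega> \<in> space M" for \<omega>
    using walk_range_centres[of S \<omega> N] srw that by (simp add: simple_random_walk_def)
  have meas: "(\<lambda>\<omega>. real (card (walk_range S (N \<omega>) \<omega>) + 2)) \<in> borel_measurable M"
  proof -
    have "(\<lambda>\<omega>. real (card (centres 0 (?Y \<omega>)) + 2)) \<in> borel_measurable M"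
      by (rule measurable_compose[OF Ymeas]) simp
    then show ?thesis by (simp add: wr cong: measurable_cong)
  qed
  have target: "cdf (distr M borel (\<lambda>\<omega>. real (card (walk_range S (N \<omega>) \<omega>) + 2))) z = q (\<lambda>k. real k \<le> z)" for z
    unfolding cdf_def q_def
    by (subst measure_distr[OF meas]) (auto simp: wr intro!: arg_cong[where f = prob])
  have source: "cdf (hom_range_size_distr (n j) (d j)) z = m j (\<lambda>k. real k \<le> z)" for j z
    unfolding cdf_def m_def hom_range_size_distr_def
    by (subst measure_distr) (auto intro!: arg_cong[where f = "measure _"])
  show ?thesis
    unfolding weak_conv_m_def weak_conv_def source target using lim by blast
qed

theorem theorem2p5:
  fixes lam :: real and n d :: "nat \<Rightarrow> nat"
    and M :: "'a measure" and S :: "nat \<Rightarrow> 'a \<Rightarrow> int" and Nplus Nminus :: "'a \<Rightarrow> nat"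
  assumes "0 < lam"
    and "\<forall>j\<ge>1. 1 \<le> n j" and "\<forall>j\<ge>1. 1 \<le> d j"
    and "filterlim n at_top sequentially"
    and "(\<lambda>j. real (n j) * 2 powr (- real (d j))) \<longlonglongrightarrow> lam"
    and "simple_random_walk M S"
    and "independent_time M S Nplus
           (parity_biased_poisson (lam / (2 * sqrt 2)) (3 / (2 * sqrt 2)))"
    and "independent_time M S Nminus
           (parity_biased_poisson (lam / (2 * sqrt 2)) (2 * sqrt 2 / 3))"
  shows "((\<forall>j\<ge>1. even (n j)) \<longrightarrow>
           weak_conv_m (\<lambda>j. hom_range_size_distr (n j) (d j))
             (distr M borel (\<lambda>\<omega>. real (card (walk_range S (Nplus \<omega>) \<omega>) + 2)))) \<and>
         ((\<forall>j\<ge>1. odd (n j)) \<longrightarrow>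
           weak_conv_m (\<lambda>j. hom_range_size_distr (n j) (d j))
             (distr M borel (\<lambda>\<omega>. real (card (walk_range S (Nminus \<omega>) \<omega>) + 2))))"
proof (intro conjI impI)
  \<comment> \<open>The hypotheses start at index 1, so they enter only as eventual
    statements.\<close>
  have nd: "\<forall>\<^sub>F j in sequentially. 1 \<le> n j \<and> 1 \<le> d j"
    using assms(2,3) by (auto simp: eventually_sequentially)
  \<comment> \<open>Even \<open>n\<close> corresponds to \<open>b = 0\<close> and odd
    \<open>n\<close> to \<open>b = 1\<close>, which inverts the ratio.\<close>
  have par_ratio: "3 / (2 * sqrt 2) = par 0 / par (Suc 0)" "2 * sqrt 2 / 3 = par 1 / par (Suc 1)"
    by (simp_all add: par_def)
  {
    assume "\<forall>j\<ge>1. even (n j)"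
    then have parity: "\<forall>\<^sub>F j in sequentially. even (n j) \<longleftrightarrow> even (0::nat)"
      by (auto simp: eventually_sequentially)
    show "weak_conv_m (\<lambda>j. hom_range_size_distr (n j) (d j))
        (distr M borel (\<lambda>\<omega>. real (card (walk_range S (Nplus \<omega>) \<omega>) + 2)))"
      by (rule range_weak_conv[OF assms(1,4,5) parity nd assms(6) assms(7)[unfolded par_ratio]])
  next
    assume "\<forall>j\<ge>1. odd (n j)"
    then have parity: "\<forall>\<^sub>F j in sequentially. even (n j) \<longleftrightarrow> even (1::nat)"
      by (auto simp: eventually_sequentially)
    show "weak_conv_m (\<lambda>j. hom_range_size_distr (n j) (d j))
        (distr M borel (\<lambda>\<omega>. real (card (walk_range S (Nminus \<omega>) \<omega>) + 2)))"
      by (rule range_weak_conv[OF assms(1,4,5) parity nd assms(6) assms(8)[unfolded par_ratio]])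
  }
qed

end
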